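(* Let $W$ be the stationary waiting time of a G/G/1 queue whose service time has finite third moment, let $\eta$ be the probability of a finite (first) ladder epoch of the random walk determining the evolution of the queue, and let $Y_1$ be the first ladder height of this walk. Assume $0<\eta<1$. Let $Z\sim\mathrm{Exp}(1)$ and \[ \widetilde W=\frac{1-\eta}{\eta\,\mathbb{E}[Y_1]}\,W . \] Then \[ d_{\mathrm W}(\mathcal L(\widetilde W),\mathcal L(Z))\le\frac{\mathbb{E}[Y_1^2]}{(\mathbb{E}[Y_1])^2}\,\frac{1-\eta}{\eta}. \] The $O(1-\eta)$ rate as $\eta\to1$ in this bound is optimal.
   Context: For non-negative random variables $U,V$, the Wasserstein distance is $d_{\mathrm W}(\mathcal L(U),\mathcal L(V))=\sup_{h\in\mathrm{Lip}(1)}|\mathbb{E}[h(U)]-\mathbb{E}[h(V)]|$, where $\mathrm{Lip}(1)=\{h:[0,\infty)\to\mathbb{R} : |h(x)-h(y)|\le|x-y|\ \forall x,y\ge0\}$; $\mathcal L(U)$ denotes the law of $U$. G/G/1 queue: a single-server queue with infinite buffer, serving customers in order of arrival, with i.i.d. non-negative service times $S_1,S_2,\ldots$ and, independently of these, i.i.d. non-negative inter-arrival times ($X_i$ is the time between the $i$th and $(i+1)$th arrivals). Put $U_i=S_i-X_{i+1}$, $\Sigma_0=0$, $\Sigma_i=\sum_{j=1}^iU_j$; this is the random walk determining the evolution of the queue. The stationary waiting time is $W=\max_{i\ge0}\Sigma_i$ (in law). Ladder epochs: $L(0)=0$ and $L(n+1)=\min\{i>L(n):\Sigma_i>\Sigma_{L(n)}\}$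 (with $L(n+1)=\infty$ if there is no such $i$). Set $\eta=\mathbb{P}(\Sigma_n>0\text{ for some }n\ge1)=\mathbb{P}(L(1)<\infty)$. The first ladder height is $Y_1=\Sigma_{L(1)}$; its law and its moments $\mathbb{E}[Y_1]$, $\mathbb{E}[Y_1^2]$ are understood conditionally on $L(1)<\infty$. *)

theory Defs
  imports "HOL-Probability.Probability"
begin

text \<open>Wasserstein distance of two laws on the half-line, given as Borel measures on the reals.
  The test functions are only constrained on \<open>[0,\<infinity>)\<close>, so the expectations are
  integrals over \<open>{0..}\<close>; the values of \<open>h\<close> at negative arguments play no role.\<close>

definition wasserstein_dist :: "real measure \<Rightarrow> real measure \<Rightarrow> ereal" where
  "wasserstein_dist \<mu> \<nu> =
     (SUP h \<in> {h :: real \<Rightarrow> real. 1-lipschitz_on {0..} h}.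
        ereal \<bar>(LINT x:{0..}|\<mu>. h x) - (LINT x:{0..}|\<nu>. h x)\<bar>)"

definition exp_law :: "real \<Rightarrow> real measure" where
  "exp_law l = density lborel (exponential_density l)"

text \<open>\<open>S i\<close> is the \<open>i\<close>th service time and \<open>X i\<close> the time between the \<open>i\<close>th and \<open>(i+1)\<close>st
  arrivals, for \<open>i \<ge> 1\<close>; the index \<open>0\<close> is not used. Joint independence of the family indexed by
  the disjoint sum says that each sequence is independent and that the two
  sequences are independent of each other.\<close>

locale gg1_queue = prob_space M for M :: "'a measure" +
  fixes S X :: "nat \<Rightarrow> 'a \<Rightarrow> real"
  assumes indep: "indep_vars (\<lambda>_. borel) (case_sum S X) ({1..} <+> {1..})"
    and ident_service: "\<And>i. i \<ge> 1 \<Longrightarrow> distr M borel (S i) = distr M borel (S 1)"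
    and ident_arrival: "\<And>i. i \<ge> 1 \<Longrightarrow> distr M borel (X i) = distr M borel (X 1)"
    and nonneg_service: "\<And>i. i \<ge> 1 \<Longrightarrow> AE \<omega> in M. 0 \<le> S i \<omega>"
    and nonneg_arrival: "\<And>i. i \<ge> 1 \<Longrightarrow> AE \<omega> in M. 0 \<le> X i \<omega>"

definition walk :: "(nat \<Rightarrow> 'a \<Rightarrow> real) \<Rightarrow> (nat \<Rightarrow> 'a \<Rightarrow> real) \<Rightarrow> nat \<Rightarrow> 'a \<Rightarrow> real" where
  "walk S X n \<omega> = (\<Sum>j=1..n. S j \<omega> - X (j + 1) \<omega>)"

text \<open>The supremum is taken in the reals. It is meaningful on paths where the walk is bounded above,
  which is almost every path if \<open>ladder_prob M S X < 1\<close>.\<close>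

definition waiting_time :: "(nat \<Rightarrow> 'a \<Rightarrow> real) \<Rightarrow> (nat \<Rightarrow> 'a \<Rightarrow> real) \<Rightarrow> 'a \<Rightarrow> real" where
  "waiting_time S X \<omega> = (SUP i. walk S X i \<omega>)"

text \<open>Strict ascending ladder epochs of a path \<open>\<sigma>\<close>; the infimum of the empty set is \<open>\<infinity>\<close>, and
  all later epochs are then \<open>\<infinity>\<close> too.\<close>

primrec ladder_epoch :: "(nat \<Rightarrow> real) \<Rightarrow> nat \<Rightarrow> enat" where
  "ladder_epoch \<sigma> 0 = 0"
| "ladder_epoch \<sigma> (Suc n) =
     (INF i \<in> {i. ladder_epoch \<sigma> n < enat i \<and> \<sigma> (the_enat (ladder_epoch \<sigma> n)) < \<sigma> i}. enat i)"

definition finite_ladder_event ::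
    "'a measure \<Rightarrow> (nat \<Rightarrow> 'a \<Rightarrow> real) \<Rightarrow> (nat \<Rightarrow> 'a \<Rightarrow> real) \<Rightarrow> 'a set" where
  "finite_ladder_event M S X = {\<omega> \<in> space M. ladder_epoch (\<lambda>i. walk S X i \<omega>) 1 < \<infinity>}"

definition ladder_prob ::
    "'a measure \<Rightarrow> (nat \<Rightarrow> 'a \<Rightarrow> real) \<Rightarrow> (nat \<Rightarrow> 'a \<Rightarrow> real) \<Rightarrow> real" where
  "ladder_prob M S X = measure M (finite_ladder_event M S X)"

definition ladder_height :: "(nat \<Rightarrow> 'a \<Rightarrow> real) \<Rightarrow> (nat \<Rightarrow> 'a \<Rightarrow> real) \<Rightarrow> 'a \<Rightarrow> real" where
  "ladder_height S X \<omega> = walk S X (the_enat (ladder_epoch (\<lambda>i. walk S X i \<omega>) 1)) \<omega>"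

text \<open>Law of the first ladder height conditionally on the first ladder epoch being finite.\<close>

definition ladder_height_law ::
    "'a measure \<Rightarrow> (nat \<Rightarrow> 'a \<Rightarrow> real) \<Rightarrow> (nat \<Rightarrow> 'a \<Rightarrow> real) \<Rightarrow> real measure" where
  "ladder_height_law M S X =
     distr (uniform_measure M (finite_ladder_event M S X)) borel (ladder_height S X)"

definition ladder_moment ::
    "'a measure \<Rightarrow> (nat \<Rightarrow> 'a \<Rightarrow> real) \<Rightarrow> (nat \<Rightarrow> 'a \<Rightarrow> real) \<Rightarrow> nat \<Rightarrow> real" where
  "ladder_moment M S X k = (LINT y|ladder_height_law M S X. y ^ k)"

definition scaled_waiting_time ::
    "'a measure \<Rightarrow> (nat \<Rightarrow> 'a \<Rightarrow> real) \<Rightarrow> (nat \<Rightarrow> 'a \<Rightarrow> real) \<Rightarrow> 'a \<Rightarrow> real" where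
  "scaled_waiting_time M S X \<omega> =
     (1 - ladder_prob M S X) / (ladder_prob M S X * ladder_moment M S X 1) * waiting_time S X \<omega>"

end

theory Submission
  imports Defs
begin

text \<open>By the strong Markov property at the first ladder epoch, \<open>W\<close> is \<open>0\<close> with probability
  \<open>1 - \<eta>\<close> and otherwise \<open>Y\<^sub>1\<close> plus an independent copy of \<open>W\<close>. Put
  \<open>a = (1 - \<eta>) / (\<eta> E Y\<^sub>1)\<close> and, for a Lipschitz function \<open>h\<close>, let \<open>g x = E h (x + Z)\<close>, so that
  \<open>g' = g - h\<close> is \<open>2\<close>-Lipschitz. The fixed point equation applied to \<open>g\<close> gives
  \<open>E h (a W) - E h Z = \<eta> / (1 - \<eta>) * E (g (a W + a Y\<^sub>1) - g (a W) - a Y\<^sub>1 * g' (a W))\<close>, where \<open>Y\<^sub>1\<close> is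
  independent of \<open>W\<close>, and by Taylor's formula the remainder is at most \<open>(a Y\<^sub>1)\<^sup>2\<close>.

  The second moment of \<open>Y\<^sub>1\<close> is finite because a walk with \<open>\<eta> < 1\<close> spends a bounded expected time in
  every interval of a fixed length, so that the position before the first ladder epoch integrates
  the overshoot at the cost of one moment of the service time. For the optimality, a simple random
  walk makes \<open>W\<close> geometric.\<close>

section \<open>Paths and their first ladder epoch\<close>

text \<open>All path arguments take place on the product space of step sequences, where a path
  splits into its first n steps and an independent tail; the queue enters only through the law of
  its increments. The scaling \<open>a\<close> is forced: it makes the expectation of
  \<open>a Y\<^sub>1\<close> over the ladder event equal to 1 - \<eta>, so that the first-order term
  (1 - \<eta>) E g'(aW) and the difference (1 - \<eta>) E g(aW) combine to (1 - \<eta>) E h(aW). No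
  drift is assumed, so every finiteness statement has to come from \<eta> < 1: the almost sure
  existence of the maximum and the integrability of W by comparing a quantity with \<eta> times
  itself, the bound on the visits from the probability 1 - \<eta> of never rising again. Finiteness
  of the second moment is a real issue, because the integral of a non-integrable function is 0 by
  convention. In the example for the rate the ratio of moments has to stay bounded; otherwise a gap
  of order 1 - \<eta> would not show that the upper bound has the right order.\<close>

definition psum :: "(nat \<Rightarrow> real) \<Rightarrow> nat \<Rightarrow> real" where
  "psum u n = (\<Sum>j<n. u j)"

definition shift_seq :: "nat \<Rightarrow> (nat \<Rightarrow> real) \<Rightarrow> nat \<Rightarrow> real" where
  "shift_seq n u j = u (n + j)"

definition ascends :: "(nat \<Rightarrow> real) \<Rightarrow> bool" where
  "ascends u \<longleftrightarrow> (\<exists>n. 0 < psum u n)"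

text \<open>On paths that never become positive this is an unspecified number, so \<open>hit\<close>
  is always paired with \<open>ascends\<close>.\<close>

definition hit :: "(nat \<Rightarrow> real) \<Rightarrow> nat" where
  "hit u = (LEAST n. 0 < psum u n)"

definition first_height :: "(nat \<Rightarrow> real) \<Rightarrow> real" where
  "first_height u = psum u (hit u)"

text \<open>An attained maximum makes the real supremum \<open>walk_sup\<close> equal to a partial
  sum, so no boundedness side conditions arise later.\<close>

definition attains_max :: "(nat \<Rightarrow> real) \<Rightarrow> bool" where
  "attains_max u \<longleftrightarrow> (\<exists>i. \<forall>j. psum u j \<le> psum u i)"

definition walk_sup :: "(nat \<Rightarrow> real) \<Rightarrow> real" where
  "walk_sup u = (SUP n. psum u n)"

lemma psum_0 [simp]: "psum u 0 = 0"
  by (simp add: psum_def)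

lemma psum_Suc: "psum u (Suc n) = psum u n + u n"
  by (simp add: psum_def)

lemma psum_add: "psum u (n + m) = psum u n + psum (shift_seq n u) m"
  by (induction m) (simp_all add: psum_Suc shift_seq_def)

lemma psum_comb_seq: "m \<le> n \<Longrightarrow> psum (comb_seq n u v) m = psum u m"
  by (simp add: psum_def comb_seq_def)

lemma shift_seq_comb_seq [simp]: "shift_seq n (comb_seq n u v) = v"
  by (simp add: shift_seq_def comb_seq_def fun_eq_iff)

lemma psum_hit: "ascends u \<Longrightarrow> 0 < psum u (hit u)"
  unfolding ascends_def hit_def by (rule LeastI_ex)

lemma first_height_pos: "ascends u \<Longrightarrow> 0 < first_height u"
  by (simp add: first_height_def psum_hit)

lemma psum_before_hit: "n < hit u \<Longrightarrow> psum u n \<le> 0"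
  unfolding hit_def using not_less_Least linorder_not_less by metis

text \<open>The right-hand side mentions only partial sums up to \<open>n\<close>: the first ladder
  epoch is a stopping time.\<close>

lemma hit_eq_iff: "ascends u \<and> hit u = n \<longleftrightarrow> 0 < psum u n \<and> (\<forall>m<n. psum u m \<le> 0)"
proof (intro iffI conjI)
  assume *: "0 < psum u n \<and> (\<forall>m<n. psum u m \<le> 0)"
  then show "ascends u" by (auto simp: ascends_def)
  show "hit u = n"
    unfolding hit_def using * by (intro Least_equality) (auto simp: not_less[symmetric])
qed (auto simp: psum_hit psum_before_hit)

lemma hit_comb_seq: "ascends (comb_seq n u v) \<and> hit (comb_seq n u v) = n \<longleftrightarrow> ascends u \<and> hit u = n"
  by (simp add: hit_eq_iff psum_comb_seq)

text \<open>A maximiser of the shifted path stays one for the whole path: its height is at least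
  \<open>psum u (hit u)\<close>, hence positive, while all sums before \<open>hit u\<close> are at
  most 0.\<close>

lemma max_after_hit:
  assumes "ascends u" and i: "\<And>j. psum (shift_seq (hit u) u) j \<le> psum (shift_seq (hit u) u) i"
  shows "psum u j \<le> psum u (hit u + i)"
proof (cases "j < hit u")
  case True
  have "psum u j \<le> 0" using True by (rule psum_before_hit)
  also have "0 \<le> psum u (hit u) + psum (shift_seq (hit u) u) i"
    using psum_hit[OF assms(1)] i[of 0] by simp
  finally show ?thesis by (simp add: psum_add)
next
  case False
  then have "psum u j = psum u (hit u) + psum (shift_seq (hit u) u) (j - hit u)"
    by (simp flip: psum_add)
  then show ?thesis using i[of "j - hit u"] by (simp add: psum_add)
qed

lemma attains_max_shift: "ascends u \<Longrightarrow> attains_max (shift_seq (hit u) u) \<Longrightarrow> attains_max u"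
  unfolding attains_max_def using max_after_hit by metis

lemma not_ascends_max: "\<not> ascends u \<Longrightarrow> attains_max u"
  unfolding ascends_def attains_max_def by (intro exI[of _ 0]) (simp add: not_less)

lemma walk_sup_eqI: "(\<And>j. psum u j \<le> psum u i) \<Longrightarrow> walk_sup u = psum u i"
  unfolding walk_sup_def by (intro cSup_eq_maximum) auto

lemma walk_sup_nonneg: "attains_max u \<Longrightarrow> 0 \<le> walk_sup u"
  unfolding attains_max_def by (metis walk_sup_eqI psum_0)

lemma walk_sup_not_ascends: "\<not> ascends u \<Longrightarrow> walk_sup u = 0"
  using walk_sup_eqI[of u 0] by (simp add: ascends_def not_less)

lemma walk_sup_ascends:
  assumes "ascends u" "attains_max (shift_seq (hit u) u)"
  shows "walk_sup u = first_height u + walk_sup (shift_seq (hit u) u)"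
proof -
  obtain i where i: "\<And>j. psum (shift_seq (hit u) u) j \<le> psum (shift_seq (hit u) u) i"
    using assms(2) by (auto simp: attains_max_def)
  have "walk_sup u = psum u (hit u + i)"
    using max_after_hit[OF assms(1) i] by (rule walk_sup_eqI)
  also have "\<dots> = first_height u + psum (shift_seq (hit u) u) i"
    by (simp add: first_height_def psum_add)
  also have "psum (shift_seq (hit u) u) i = walk_sup (shift_seq (hit u) u)"
    using i by (rule walk_sup_eqI[symmetric])
  finally show ?thesis .
qed

section \<open>Measurability of the path functionals\<close>

lemma measurable_psum [measurable]: "(\<lambda>u. psum u n) \<in> borel_measurable (\<Pi>\<^sub>M i\<in>UNIV. borel)"
  unfolding psum_def by measurable

lemma measurable_shift_seq [measurable]:
  "shift_seq n \<in> measurable (\<Pi>\<^sub>M i\<in>UNIV. borel) (\<Pi>\<^sub>M i\<in>UNIV. borel)"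
proof -
  have "shift_seq n = (\<lambda>u j. u (n + j))" by (simp add: fun_eq_iff shift_seq_def)
  then show ?thesis by (auto intro!: measurable_PiM_single' simp: space_PiM)
qed

lemma measurable_ascends [measurable]: "Measurable.pred (\<Pi>\<^sub>M i\<in>UNIV. borel) ascends"
  unfolding ascends_def by measurable

lemma measurable_hit [measurable]: "hit \<in> measurable (\<Pi>\<^sub>M i\<in>UNIV. borel) (count_space UNIV)"
  unfolding hit_def by measurable

lemma measurable_first_height [measurable]: "first_height \<in> borel_measurable (\<Pi>\<^sub>M i\<in>UNIV. borel)"
  unfolding first_height_def
  by (rule measurable_compose_countable[where f="\<lambda>n u. psum u n"]) measurable

lemma measurable_shift_hit [measurable]:
  "(\<lambda>u. shift_seq (hit u) u) \<in> measurable (\<Pi>\<^sub>M i\<in>UNIV. borel) (\<Pi>\<^sub>M i\<in>UNIV. borel)"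
  by (rule measurable_compose_countable[where f="\<lambda>n u. shift_seq n u"]) measurable

lemma measurable_attains_max [measurable]: "Measurable.pred (\<Pi>\<^sub>M i\<in>UNIV. borel) attains_max"
proof -
  have [measurable]: "Measurable.pred (\<Pi>\<^sub>M i\<in>UNIV. borel) (\<lambda>u. psum u j \<le> psum u i)" for i j
    unfolding pred_def by (intro borel_measurable_le measurable_psum)
  show ?thesis
    unfolding attains_max_def by measurable
qed

text \<open>The supremum of an unbounded set of reals is a fixed junk value, so \<open>walk_sup\<close> is
  measurable without any restriction to bounded paths.\<close>

lemma Sup_unbounded_real:
  assumes "\<not> bdd_above (A :: real set)" "\<not> bdd_above B"
  shows "Sup A = Sup B"
proof -
  have "(\<forall>x\<in>A. x \<le> z) = (\<forall>x\<in>B. x \<le> z)" for z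
    using assms unfolding bdd_above_def by blast
  then show ?thesis by (simp add: Sup_real_def)
qed

lemma measurable_walk_sup [measurable]: "walk_sup \<in> borel_measurable (\<Pi>\<^sub>M i\<in>UNIV. borel)"
proof -
  \<comment> \<open>Bounds \<open>N\<close> in the naturals suffice and make boundedness a countable
    condition.\<close>
  define B where "B u \<longleftrightarrow> (\<exists>N::nat. \<forall>n. psum u n \<le> N)" for u
  have B: "B u \<longleftrightarrow> bdd_above (range (psum u))" for u
    unfolding B_def bdd_above_def image_iff
    by (auto intro: order_trans[OF _ real_nat_ceiling_ge])
  have [measurable]: "Measurable.pred (\<Pi>\<^sub>M i\<in>UNIV. borel) B"
    unfolding B_def by measurable
  have nb: "\<not> bdd_above (UNIV :: real set)"
    by (auto simp: bdd_above_def not_le gt_ex)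
  \<comment> \<open>The countable supremum rule asks for a family bounded at every point, so the
    inner conditional replaces unbounded paths by 0.\<close>
  have eq: "walk_sup = (\<lambda>u. if B u then (SUP n. if B u then psum u n else 0) else Sup (UNIV :: real set))"
    by (auto simp: fun_eq_iff walk_sup_def B nb intro!: Sup_unbounded_real)
  have bdd: "bdd_above (range (\<lambda>n. if B u then psum u n else 0))" for u
    by (cases "B u") (simp_all add: B)
  have [measurable]: "(\<lambda>u. (SUP n. if B u then psum u n else 0)) \<in> borel_measurable (\<Pi>\<^sub>M i\<in>UNIV. borel)"
    by (intro borel_measurable_cSUP bdd) measurable
  show ?thesis
    unfolding eq by measurable
qed

section \<open>Walks with independent identically distributed steps\<close>

locale iid_walk = real_distribution D for D :: "real measure"
begin

sublocale seq: sequence_space D ..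

abbreviation P :: "(nat \<Rightarrow> real) measure" where
  "P \<equiv> \<Pi>\<^sub>M i\<in>UNIV. D"

lemma sets_P [measurable_cong]: "sets P = sets (\<Pi>\<^sub>M i\<in>UNIV. borel)"
  by (intro sets_PiM_cong) auto

lemma space_P [simp]: "space P = UNIV"
  by (simp add: space_PiM)

text \<open>Gluing the first \<open>n\<close> steps of one path to an independent second path
  reproduces \<open>P\<close>. The second hypothesis says that \<phi> sees its first argument only
  through these \<open>n\<close> steps.\<close>

lemma nn_integral_split:
  assumes [measurable]: "\<phi> \<in> borel_measurable (P \<Otimes>\<^sub>M P)"
    and "\<And>u v w. \<phi> (comb_seq n u v, w) = \<phi> (u, w)"
  shows "(\<integral>\<^sup>+u. \<phi> (u, shift_seq n u) \<partial>P) = (\<integral>\<^sup>+u. \<integral>\<^sup>+v. \<phi> (u, v) \<partial>P \<partial>P)"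
proof -
  have "(\<integral>\<^sup>+u. \<phi> (u, shift_seq n u) \<partial>P) =
      (\<integral>\<^sup>+u. \<phi> (u, shift_seq n u) \<partial>distr (P \<Otimes>\<^sub>M P) P (\<lambda>(\<omega>, \<omega>'). comb_seq n \<omega> \<omega>'))"
    by (simp only: seq.PiM_comb_seq)
  also have "\<dots> = (\<integral>\<^sup>+z. \<phi> z \<partial>(P \<Otimes>\<^sub>M P))"
    by (subst nn_integral_distr) (auto intro!: nn_integral_cong simp: assms(2))
  also have "\<dots> = (\<integral>\<^sup>+u. \<integral>\<^sup>+v. \<phi> (u, v) \<partial>P \<partial>P)"
    by (intro seq.P.nn_integral_fst[symmetric]) measurable
  finally show ?thesis .
qed

lemma nn_integral_mult_split:
  assumes [measurable]: "f \<in> borel_measurable P" "g \<in> borel_measurable P"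
    and "\<And>u v. f (comb_seq n u v) = f u"
  shows "(\<integral>\<^sup>+u. f u * g (shift_seq n u) \<partial>P) = (\<integral>\<^sup>+u. f u \<partial>P) * (\<integral>\<^sup>+u. g u \<partial>P)"
  using nn_integral_split[of "\<lambda>(u, v). f u * g v" n] assms
  by (simp add: nn_integral_cmult nn_integral_multc)

text \<open>Partition by the value \<open>n\<close> of \<open>hit\<close>: on each piece the event
  and the height depend on the first \<open>n\<close> steps only, so the deterministic split
  applies. Nonnegative integrands let the sum over \<open>n\<close> pass through the integrals
  freely.\<close>

lemma strong_markov:
  assumes [measurable]: "\<phi> \<in> borel_measurable (borel \<Otimes>\<^sub>M P)"
  shows "(\<integral>\<^sup>+u. indicator {u. ascends u} u * \<phi> (first_height u, shift_seq (hit u) u) \<partial>P) =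
    (\<integral>\<^sup>+u. \<integral>\<^sup>+v. indicator {u. ascends u} u * \<phi> (first_height u, v) \<partial>P \<partial>P)"
proof -
  define A where "A n = {u. ascends u \<and> hit u = n}" for n
  have [measurable]: "A n \<in> sets P" for n
  proof -
    have "A n = {u \<in> space P. ascends u \<and> hit u = n}" by (simp add: A_def)
    also have "\<dots> \<in> sets P" by measurable
    finally show ?thesis .
  qed
  have sum_A: "(\<Sum>n. indicator (A n) u * (F n :: ennreal)) = indicator {u. ascends u} u * F (hit u)" for u F
  proof -
    have "(\<Sum>n. indicator (A n) u * F n) = (\<Sum>n\<in>{hit u}. indicator (A n) u * F n)"
      by (intro suminf_finite) (auto simp: A_def)
    then show ?thesis by (simp add: A_def indicator_def)
  qed
  have "(\<integral>\<^sup>+u. indicator {u. ascends u} u * \<phi> (first_height u, shift_seq (hit u) u) \<partial>P)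
      = (\<integral>\<^sup>+u. (\<Sum>n. indicator (A n) u * \<phi> (psum u n, shift_seq n u)) \<partial>P)"
    by (intro nn_integral_cong) (simp add: sum_A first_height_def)
  also have "\<dots> = (\<Sum>n. \<integral>\<^sup>+u. indicator (A n) u * \<phi> (psum u n, shift_seq n u) \<partial>P)"
    by (intro nn_integral_suminf) measurable
  also have "\<dots> = (\<Sum>n. \<integral>\<^sup>+u. \<integral>\<^sup>+v. indicator (A n) u * \<phi> (psum u n, v) \<partial>P \<partial>P)"
  proof (intro suminf_cong)
    fix n
    show "(\<integral>\<^sup>+u. indicator (A n) u * \<phi> (psum u n, shift_seq n u) \<partial>P) =
        (\<integral>\<^sup>+u. \<integral>\<^sup>+v. indicator (A n) u * \<phi> (psum u n, v) \<partial>P \<partial>P)"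
      using nn_integral_split[of "\<lambda>(u, v). indicator (A n) u * \<phi> (psum u n, v)" n]
      by (simp add: psum_comb_seq A_def indicator_def hit_comb_seq)
  qed
  also have "\<dots> = (\<integral>\<^sup>+u. (\<Sum>n. \<integral>\<^sup>+v. indicator (A n) u * \<phi> (psum u n, v) \<partial>P) \<partial>P)"
    by (intro nn_integral_suminf[symmetric]) measurable
  also have "\<dots> = (\<integral>\<^sup>+u. (\<Sum>n. indicator (A n) u * (\<integral>\<^sup>+v. \<phi> (psum u n, v) \<partial>P)) \<partial>P)"
    by (intro nn_integral_cong suminf_cong nn_integral_cmult) measurable
  also have "\<dots> = (\<integral>\<^sup>+u. indicator {u. ascends u} u * (\<integral>\<^sup>+v. \<phi> (first_height u, v) \<partial>P) \<partial>P)"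
    by (intro nn_integral_cong) (simp add: sum_A first_height_def)
  also have "\<dots> = (\<integral>\<^sup>+u. \<integral>\<^sup>+v. indicator {u. ascends u} u * \<phi> (first_height u, v) \<partial>P \<partial>P)"
    by (intro nn_integral_cong nn_integral_cmult[symmetric]) measurable
  finally show ?thesis .
qed


section \<open>Existence of the maximum and the fixed point equation\<close>

abbreviation \<eta> :: real where
  "\<eta> \<equiv> measure P {u. ascends u}"

lemma sets_Collect_P [measurable (raw)]: "Measurable.pred P Q \<Longrightarrow> {u. Q u} \<in> sets P"
  by (simp add: pred_def)

lemma emeasure_ascends: "emeasure P {u. ascends u} = \<eta>"
  by (simp add: seq.P.emeasure_eq_measure)

lemma measure_not_ascends: "measure P {u. \<not> ascends u} = 1 - \<eta>"
proof -
  have "{u. \<not> ascends u} = space P - {u. ascends u}" by auto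
  then show ?thesis
    by (simp only:) (rule seq.P.prob_compl, measurable)
qed

lemma emeasure_not_ascends: "emeasure P {u. \<not> ascends u} = 1 - \<eta>"
  by (simp add: seq.P.emeasure_eq_measure measure_not_ascends)

text \<open>\<open>P\<close> is invariant under deterministic shifts: this is the split with the
  constant 1 as first factor.\<close>

lemma AE_shift:
  assumes [measurable]: "Measurable.pred P Q" and "AE u in P. Q u"
  shows "AE u in P. Q (shift_seq n u)"
proof -
  have "(\<integral>\<^sup>+u. indicator {u. \<not> Q u} (shift_seq n u) \<partial>P) = (\<integral>\<^sup>+u. indicator {u. \<not> Q u} u \<partial>P)"
    using nn_integral_mult_split[of "\<lambda>_. 1" "indicator {u. \<not> Q u}" n]
    by (simp add: seq.P.emeasure_space_1[simplified])
  also have "\<dots> = 0"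
    using assms(2) by (subst nn_integral_0_iff_AE) (auto simp: indicator_def)
  finally show ?thesis
    by (subst (asm) nn_integral_0_iff_AE) (auto simp: indicator_def split: if_splits)
qed

text \<open>A path without a maximum must ascend, and its continuation after \<open>hit\<close> has
  no maximum either. By the strong Markov property the probability q of this event satisfies q \<le>
  \<eta> q, hence q = 0.\<close>

lemma AE_attains_max:
  assumes "\<eta> < 1"
  shows "AE u in P. attains_max u"
proof -
  let ?N = "{u. \<not> attains_max u}"
  have "emeasure P ?N = (\<integral>\<^sup>+u. indicator ?N u \<partial>P)" by simp
  also have "\<dots> \<le> (\<integral>\<^sup>+u. indicator {u. ascends u} u * indicator ?N (shift_seq (hit u) u) \<partial>P)"
    using attains_max_shift not_ascends_max
    by (intro nn_integral_mono) (auto simp: indicator_def)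
  also have "\<dots> = (\<integral>\<^sup>+u. \<integral>\<^sup>+v. indicator {u. ascends u} u * indicator ?N v \<partial>P \<partial>P)"
    using strong_markov[of "\<lambda>(_, v). indicator ?N v"] by simp
  also have "\<dots> = ennreal \<eta> * emeasure P ?N"
    by (simp add: nn_integral_cmult nn_integral_multc emeasure_ascends)
  finally have "measure P ?N \<le> \<eta> * measure P ?N"
    by (simp add: seq.P.emeasure_eq_measure flip: ennreal_mult)
  then have "(1 - \<eta>) * measure P ?N \<le> 0" by (simp add: algebra_simps)
  with assms have "measure P ?N = 0"
    by (simp add: mult_le_0_iff measure_le_0_iff)
  then show ?thesis
    by (subst AE_iff_measurable[OF _ refl]) (simp_all add: seq.P.emeasure_eq_measure)
qed

lemma nn_integral_walk_sup:
  fixes f :: "real \<Rightarrow> ennreal"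
  assumes "\<eta> < 1" and [measurable]: "f \<in> borel_measurable borel"
  shows "(\<integral>\<^sup>+u. f (walk_sup u) \<partial>P) =
    (\<integral>\<^sup>+u. \<integral>\<^sup>+v. f (if ascends u then first_height u + walk_sup v else 0) \<partial>P \<partial>P)"
proof -
  let ?A = "{u. ascends u}" and ?B = "{u. \<not> ascends u}"
  \<comment> \<open>The shift is by a random time, which \<open>AE_shift\<close> does not cover; the
    strong Markov property carries the null set over.\<close>
  have "AE u in P. ascends u \<longrightarrow> attains_max (shift_seq (hit u) u)"
  proof -
    have "(\<integral>\<^sup>+u. indicator ?A u * indicator {u. \<not> attains_max u} (shift_seq (hit u) u) \<partial>P) =
        (\<integral>\<^sup>+u. \<integral>\<^sup>+v. indicator ?A u * indicator {u. \<not> attains_max u} v \<partial>P \<partial>P)"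
      using strong_markov[of "\<lambda>(_, v). indicator {u. \<not> attains_max u} v"] by simp
    also have "\<dots> = ennreal \<eta> * emeasure P {u. \<not> attains_max u}"
      by (simp add: nn_integral_cmult nn_integral_multc emeasure_ascends)
    also have "emeasure P {u. \<not> attains_max u} = 0"
      using AE_attains_max[OF assms(1)] by (subst (asm) AE_iff_measurable[OF _ refl]) auto
    also have "ennreal \<eta> * 0 = 0" by simp
    finally show ?thesis
      by (subst (asm) nn_integral_0_iff_AE) (auto simp: indicator_def split: if_splits)
  qed
  then have "(\<integral>\<^sup>+u. f (walk_sup u) \<partial>P) =
      (\<integral>\<^sup>+u. indicator ?A u * f (first_height u + walk_sup (shift_seq (hit u) u)) + indicator ?B u * f 0 \<partial>P)"
    by (intro nn_integral_cong_AE, elim eventually_mono)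
       (auto simp: indicator_def walk_sup_ascends walk_sup_not_ascends)
  also have "\<dots> = (\<integral>\<^sup>+u. indicator ?A u * f (first_height u + walk_sup (shift_seq (hit u) u)) \<partial>P)
      + (\<integral>\<^sup>+u. indicator ?B u * f 0 \<partial>P)"
    by (intro nn_integral_add) measurable
  also have "(\<integral>\<^sup>+u. indicator ?A u * f (first_height u + walk_sup (shift_seq (hit u) u)) \<partial>P)
      = (\<integral>\<^sup>+u. \<integral>\<^sup>+v. indicator ?A u * f (first_height u + walk_sup v) \<partial>P \<partial>P)"
    using strong_markov[of "\<lambda>(y, v). f (y + walk_sup v)"] by simp
  also have "(\<integral>\<^sup>+u. \<integral>\<^sup>+v. indicator ?A u * f (first_height u + walk_sup v) \<partial>P \<partial>P)
      + (\<integral>\<^sup>+u. indicator ?B u * f 0 \<partial>P) =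
      (\<integral>\<^sup>+u. (\<integral>\<^sup>+v. indicator ?A u * f (first_height u + walk_sup v) \<partial>P) + indicator ?B u * f 0 \<partial>P)"
    by (intro nn_integral_add[symmetric]) measurable
  also have "\<dots> = (\<integral>\<^sup>+u. \<integral>\<^sup>+v. f (if ascends u then first_height u + walk_sup v else 0) \<partial>P \<partial>P)"
    by (intro nn_integral_cong) (auto simp: indicator_def seq.P.emeasure_space_1[simplified])
  finally show ?thesis .
qed

text \<open>As an identity of laws the fixed point equation also serves integrands of either sign,
  such as the Stein solution.\<close>

lemma distr_walk_sup:
  assumes "\<eta> < 1"
  shows "distr P borel walk_sup =
    distr (P \<Otimes>\<^sub>M P) borel (\<lambda>(u, v). if ascends u then first_height u + walk_sup v else 0)"
proof (rule measure_eqI)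
  fix B :: "real set" assume "B \<in> sets (distr P borel walk_sup)"
  then have [measurable]: "B \<in> sets borel" by simp
  let ?g = "\<lambda>(u, v). if ascends u then first_height u + walk_sup v else 0"
  have "emeasure (distr P borel walk_sup) B = (\<integral>\<^sup>+x. indicator B x \<partial>distr P borel walk_sup)"
    by simp
  also have "\<dots> = (\<integral>\<^sup>+u. indicator B (walk_sup u) \<partial>P)"
    by (intro nn_integral_distr) measurable
  also have "\<dots> = (\<integral>\<^sup>+u. \<integral>\<^sup>+v. indicator B (?g (u, v)) \<partial>P \<partial>P)"
    using nn_integral_walk_sup[OF assms, of "indicator B"] by simp
  also have "\<dots> = (\<integral>\<^sup>+z. indicator B (?g z) \<partial>(P \<Otimes>\<^sub>M P))"
    by (intro seq.P.nn_integral_fst) measurable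
  also have "\<dots> = (\<integral>\<^sup>+x. indicator B x \<partial>distr (P \<Otimes>\<^sub>M P) borel ?g)"
    by (intro nn_integral_distr[symmetric]) measurable
  finally show "emeasure (distr P borel walk_sup) B = emeasure (distr (P \<Otimes>\<^sub>M P) borel ?g) B"
    by simp
qed simp

lemma
  fixes f :: "real \<Rightarrow> real"
  assumes "\<eta> < 1" and [measurable]: "f \<in> borel_measurable borel"
    and int: "integrable P (\<lambda>u. f (walk_sup u))"
  shows integrable_walk_sup_step: "integrable (P \<Otimes>\<^sub>M P)
      (\<lambda>(u, v). f (if ascends u then first_height u + walk_sup v else 0))"
    and integral_walk_sup_step: "(\<integral>u. f (walk_sup u) \<partial>P) =
      (\<integral>(u, v). f (if ascends u then first_height u + walk_sup v else 0) \<partial>(P \<Otimes>\<^sub>M P))"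
proof -
  let ?g = "\<lambda>(u, v). if ascends u then first_height u + walk_sup v else 0"
  have "integrable (distr P borel walk_sup) f"
    using int by (subst integrable_distr_eq) measurable
  then show "integrable (P \<Otimes>\<^sub>M P) (\<lambda>(u, v). f (if ascends u then first_height u + walk_sup v else 0))"
    unfolding distr_walk_sup[OF assms(1)]
    by (subst (asm) integrable_distr_eq) (auto simp: case_prod_beta')
  have "(\<integral>u. f (walk_sup u) \<partial>P) = (\<integral>x. f x \<partial>distr P borel walk_sup)"
    by (intro integral_distr[symmetric]) measurable
  also have "\<dots> = (\<integral>z. f (?g z) \<partial>(P \<Otimes>\<^sub>M P))"
    unfolding distr_walk_sup[OF assms(1)] by (intro integral_distr) measurable
  finally show "(\<integral>u. f (walk_sup u) \<partial>P) =
      (\<integral>(u, v). f (if ascends u then first_height u + walk_sup v else 0) \<partial>(P \<Otimes>\<^sub>M P))"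
    by (simp add: case_prod_beta')
qed

text \<open>The inequality E W \<le> m + \<eta> E W bounds E W only if E W is already known to be
  finite. It is therefore proved for the truncations \<open>min W n\<close>, with a bound
  independent of \<open>n\<close>, followed by monotone convergence.\<close>

lemma integrable_walk_sup:
  assumes "\<eta> < 1"
    and int: "integrable P (\<lambda>u. indicator {u. ascends u} u * first_height u)"
  shows "integrable P walk_sup"
proof -
  let ?A = "{u. ascends u}"
  define m where "m = (\<integral>u. indicator ?A u * first_height u \<partial>P)"
  have nonneg: "AE u in P. 0 \<le> walk_sup u"
    using AE_attains_max[OF assms(1)] by eventually_elim (rule walk_sup_nonneg)
  have "m \<ge> 0"
    unfolding m_def by (intro Bochner_Integration.integral_nonneg) (auto simp: indicator_def intro: less_imp_le[OF first_height_pos])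
  have bound: "(\<integral>\<^sup>+u. ennreal (min (walk_sup u) (real n)) \<partial>P) \<le> ennreal (m / (1 - \<eta>))" for n
  proof -
    let ?f = "\<lambda>x. ennreal (min x (real n))"
    define E where "E = (\<integral>\<^sup>+u. ?f (walk_sup u) \<partial>P)"
    have "E \<le> (\<integral>\<^sup>+u. real n \<partial>P)"
      unfolding E_def by (intro nn_integral_mono ennreal_leI) simp
    then have "E < \<infinity>"
      by (simp add: seq.P.emeasure_space_1[simplified] ennreal_less_top le_less_trans)
    then obtain e where e: "E = ennreal e" "0 \<le> e" by (cases E) auto
    have "E = (\<integral>\<^sup>+u. \<integral>\<^sup>+v. ?f (if ascends u then first_height u + walk_sup v else 0) \<partial>P \<partial>P)"
      unfolding E_def by (intro nn_integral_walk_sup[OF assms(1)]) measurable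
    also have "\<dots> \<le> (\<integral>\<^sup>+u. \<integral>\<^sup>+v. ennreal (indicator ?A u * first_height u) + indicator ?A u * ?f (walk_sup v) \<partial>P \<partial>P)"
    proof (intro nn_integral_mono)
      fix u v :: "nat \<Rightarrow> real"
      show "?f (if ascends u then first_height u + walk_sup v else 0) \<le>
          ennreal (indicator ?A u * first_height u) + indicator ?A u * ?f (walk_sup v)"
      proof (cases "ascends u")
        case True
        \<comment> \<open>The \<open>max 0\<close> is there because \<open>walk_sup v\<close> may be
          negative where the supremum is a default value; \<open>ennreal\<close> clips it to 0
          anyway.\<close>
        have "?f (first_height u + walk_sup v) \<le> ennreal (first_height u + max 0 (min (walk_sup v) (real n)))"
          using first_height_pos[OF True] by (intro ennreal_leI) (auto simp: min_def max_def)
        also have "\<dots> = ennreal (first_height u) + ?f (walk_sup v)"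
          using first_height_pos[OF True] by (subst ennreal_plus) (auto simp: max_def ennreal_neg)
        finally show ?thesis using True by simp
      qed simp
    qed
    also have "\<dots> = (\<integral>\<^sup>+u. ennreal (indicator ?A u * first_height u) + indicator ?A u * E \<partial>P)"
      by (intro nn_integral_cong, subst nn_integral_add)
         (auto simp: nn_integral_cmult E_def seq.P.emeasure_space_1[simplified])
    also have "\<dots> = (\<integral>\<^sup>+u. ennreal (indicator ?A u * first_height u) \<partial>P) + (\<integral>\<^sup>+u. indicator ?A u * E \<partial>P)"
      by (intro nn_integral_add) measurable
    also have "(\<integral>\<^sup>+u. ennreal (indicator ?A u * first_height u) \<partial>P) = ennreal m"
      unfolding m_def
      by (intro nn_integral_eq_integral[OF int]) (auto simp: indicator_def intro!: AE_I2 less_imp_le[OF first_height_pos])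
    also have "(\<integral>\<^sup>+u. indicator ?A u * E \<partial>P) = ennreal \<eta> * E"
      by (simp add: nn_integral_multc emeasure_ascends)
    finally have "e \<le> m + \<eta> * e"
      using e \<open>m \<ge> 0\<close> by (simp flip: ennreal_mult ennreal_plus)
    then have "e \<le> m / (1 - \<eta>)"
      using assms(1) by (simp add: field_simps)
    then show ?thesis
      unfolding E_def[symmetric] e by (rule ennreal_leI)
  qed
  have "(\<integral>\<^sup>+u. ennreal (walk_sup u) \<partial>P) = (\<integral>\<^sup>+u. (SUP n. ennreal (min (walk_sup u) (real n))) \<partial>P)"
  proof (intro nn_integral_cong antisym)
    fix u
    obtain n where "walk_sup u \<le> real n" using real_arch_simple by blast
    then have "ennreal (walk_sup u) = ennreal (min (walk_sup u) (real n))" by (simp add: min_def)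
    then show "ennreal (walk_sup u) \<le> (SUP n. ennreal (min (walk_sup u) (real n)))"
      by (metis SUP_upper UNIV_I)
  qed (auto intro!: SUP_least ennreal_leI)
  also have "\<dots> = (SUP n. \<integral>\<^sup>+u. ennreal (min (walk_sup u) (real n)) \<partial>P)"
    by (intro nn_integral_monotone_convergence_SUP) (auto simp: incseq_def le_fun_def intro!: ennreal_leI)
  also have "\<dots> \<le> ennreal (m / (1 - \<eta>))"
    by (intro SUP_least bound)
  finally show ?thesis
    using nonneg by (intro integrableI_nonneg) (auto simp: le_less_trans)
qed

end

section \<open>The second moment of the ladder height\<close>

context iid_walk
begin

lemma emeasure_split:
  assumes [measurable]: "Measurable.pred P A" "Measurable.pred P B"
    and "\<And>u v. A (comb_seq n u v) = A u"
  shows "emeasure P {u. A u \<and> B (shift_seq n u)} = emeasure P {u. A u} * emeasure P {u. B u}"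
proof -
  have [measurable]: "{u. A u \<and> B (shift_seq n u)} \<in> sets P" by measurable
  have "emeasure P {u. A u \<and> B (shift_seq n u)} = (\<integral>\<^sup>+u. indicator {u. A u \<and> B (shift_seq n u)} u \<partial>P)"
    by (rule nn_integral_indicator[symmetric]) measurable
  also have "\<dots> = (\<integral>\<^sup>+u. indicator {u. A u} u * indicator {u. B u} (shift_seq n u) \<partial>P)"
    by (intro nn_integral_cong) (simp add: indicator_def)
  also have "\<dots> = (\<integral>\<^sup>+u. indicator {u. A u} u \<partial>P) * (\<integral>\<^sup>+u. indicator {u. B u} u \<partial>P)"
    by (intro nn_integral_mult_split) (simp_all add: assms(3) indicator_def)
  finally show ?thesis by simp
qed

text \<open>A visit to an interval of length \<open>\<delta>\<close> followed by a step below \<open>- \<delta>\<close> from which the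
  walk never rises again is the last visit to this interval. Hence these events are disjoint for
  different times.\<close>

lemma expected_visits_bound:
  "(\<Sum>n. emeasure P {u. psum u n \<in> {a..<a + \<delta>}}) * (emeasure P {u. u 0 < - \<delta>} * ennreal (1 - \<eta>)) \<le> 1"
proof -
  let ?B = "{u. u 0 < - \<delta> \<and> \<not> ascends (shift_seq 1 u)}"
  let ?V = "\<lambda>n. {u. psum u n \<in> {a..<a + \<delta>}}"
  define E where "E n = {u. psum u n \<in> {a..<a + \<delta>} \<and> shift_seq n u \<in> ?B}" for n
  have B [measurable]: "?B \<in> sets P" by measurable
  have E [measurable]: "E n \<in> sets P" for n
    unfolding E_def by measurable
  have "E m \<inter> E n = {}" if "m < n" for m n
  proof -
    have False if u: "u \<in> E m" "u \<in> E n" for u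
    proof -
      let ?k = "n - Suc m"
      \<comment> \<open>Starting below \<open>a + \<delta>\<close>, falling by more than \<delta>
        and never rising again leaves the walk below \<open>a\<close> at time
        \<open>n\<close>.\<close>
      have *: "psum u n = psum u m + (u m + psum (shift_seq 1 (shift_seq m u)) ?k)"
        using \<open>m < n\<close> psum_add[of u m "Suc ?k"] psum_add[of "shift_seq m u" 1 ?k]
        by (simp add: psum_Suc[of _ 0, simplified] shift_seq_def)
      have "psum (shift_seq 1 (shift_seq m u)) ?k \<le> 0" "u m < - \<delta>"
        using u by (auto simp: E_def ascends_def not_less shift_seq_def)
      with u * show False by (auto simp: E_def)
    qed
    then show ?thesis by auto
  qed
  then have disj: "disjoint_family E"
    unfolding disjoint_family_on_def by (metis Int_commute linorder_neqE_nat)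
  have V: "emeasure P (E n) = emeasure P (?V n) * (emeasure P {u. u 0 < - \<delta>} * ennreal (1 - \<eta>))" for n
  proof -
    have "emeasure P (E n) = emeasure P (?V n) * emeasure P ?B"
      unfolding E_def mem_Collect_eq by (intro emeasure_split) (simp_all add: psum_comb_seq)
    also have "emeasure P ?B = emeasure P {u. u 0 < - \<delta>} * emeasure P {u. \<not> ascends u}"
      by (intro emeasure_split) (simp_all add: comb_seq_def)
    finally show ?thesis by (simp only: emeasure_not_ascends)
  qed
  have "(\<Sum>n. emeasure P (?V n)) * (emeasure P {u. u 0 < - \<delta>} * ennreal (1 - \<eta>)) = (\<Sum>n. emeasure P (E n))"
    by (simp add: V)
  also have "\<dots> = emeasure P (\<Union>n. E n)"
    by (intro suminf_emeasure disj) auto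
  also have "\<dots> \<le> 1" by (rule seq.P.emeasure_le_1)
  finally show ?thesis .
qed

lemma AE_zero_imp_not_ascends:
  assumes "AE u in P. u 0 = 0"
  shows "\<eta> = 0"
proof -
  have "AE u in P. shift_seq n u 0 = 0" for n
    using assms by (intro AE_shift) measurable
  then have "AE u in P. \<forall>n. u n = 0"
    by (simp add: AE_all_countable shift_seq_def)
  then have "AE u in P. \<not> ascends u"
    by eventually_elim (simp add: ascends_def psum_def)
  then have "emeasure P {u. ascends u} = 0"
    by (subst (asm) AE_iff_measurable[OF _ refl]) auto
  then show ?thesis by (simp add: seq.P.emeasure_eq_measure measure_le_0_iff)
qed

text \<open>If almost all steps were nonnegative, a path that never ascends would start with a step
  0 and then again never ascend. Thus 1 - \<eta> \<le> P(step = 0) (1 - \<eta>); cancelling 1 -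
  \<eta> > 0 makes all steps 0, against \<eta> > 0.\<close>

lemma down_step_exists:
  assumes "0 < \<eta>" "\<eta> < 1"
  obtains \<delta> where "0 < \<delta>" "0 < emeasure P {u. u 0 < - \<delta>}"
proof -
  have "\<exists>n. emeasure P {u. u 0 < - (1 / real (Suc n))} \<noteq> 0"
  proof (rule ccontr)
    assume "\<not> ?thesis"
    then have "AE u in P. \<not> u 0 < - (1 / real (Suc n))" for n
      by (subst AE_iff_measurable[OF _ refl]) auto
    then have *: "AE u in P. \<forall>n. \<not> u 0 < - (1 / real (Suc n))"
      by (simp add: AE_all_countable)
    have nonneg: "AE u in P. 0 \<le> u 0"
      using *
    proof eventually_elim
      case (elim u)
      show ?case
      proof (rule ccontr)
        assume "\<not> 0 \<le> u 0"
        then obtain n where "1 / real (Suc n) < - u 0"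
          using nat_approx_posE[of "- u 0"] by auto
        moreover from elim have "\<not> u 0 < - (1 / real (Suc n))" by blast
        ultimately show False by linarith
      qed
    qed
    let ?N = "{u. \<not> ascends u}" and ?Z = "{u. u 0 = 0}"
    have "(\<integral>\<^sup>+u. indicator ?N u \<partial>P) \<le> (\<integral>\<^sup>+u. indicator ?Z u * indicator ?N (shift_seq 1 u) \<partial>P)"
    proof (intro nn_integral_mono_AE, use nonneg in eventually_elim)
      case (elim u)
      show ?case
      proof (cases "ascends u")
        case False
        then have le: "psum u n \<le> 0" for n by (simp add: ascends_def not_less)
        from le[of 1] elim have "u 0 = 0" by (simp add: psum_def)
        moreover have "\<not> ascends (shift_seq 1 u)"
          using le[of "1 + _"] unfolding psum_add ascends_def by (simp add: psum_def \<open>u 0 = 0\<close> not_less)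
        ultimately show ?thesis by (simp add: indicator_def)
      qed simp
    qed
    also have "\<dots> = (\<integral>\<^sup>+u. indicator ?Z u \<partial>P) * (\<integral>\<^sup>+u. indicator ?N u \<partial>P)"
      by (intro nn_integral_mult_split) (auto simp: indicator_def comb_seq_def)
    finally have "measure P ?N \<le> measure P ?Z * measure P ?N"
      by (simp add: seq.P.emeasure_eq_measure flip: ennreal_mult)
    then have "1 - \<eta> \<le> measure P ?Z * (1 - \<eta>)"
      by (simp only: measure_not_ascends)
    then have "1 \<le> measure P ?Z"
      using mult_right_le_imp_le[of 1 "1 - \<eta>" "measure P ?Z"] assms(2) by simp
    then have "measure P ?Z = 1"
      using seq.P.prob_le_1[of ?Z] by (rule antisym[rotated])
    then have "AE u in P. u 0 = 0"
      by (subst (asm) seq.P.prob_eq_1) auto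
    then have "\<eta> = 0" by (rule AE_zero_imp_not_ascends)
    with assms show False by simp
  qed
  then obtain n where "emeasure P {u. u 0 < - (1 / real (Suc n))} \<noteq> 0" ..
  then show thesis
    by (intro that[of "1 / real (Suc n)"]) (auto simp: zero_less_iff_neq_zero)
qed

text \<open>\<open>C\<close> is the reciprocal of the probability of a step below
  \<open>- \<delta>\<close> followed by no ascent. Its independence of \<open>a\<close> is what
  permits the later sum over all intervals.\<close>

lemma expected_visits_finite:
  assumes "0 < \<eta>" "\<eta> < 1"
  obtains \<delta> C where "0 < \<delta>" "C < (\<infinity> :: ennreal)"
    "\<And>a. (\<Sum>n. emeasure P {u. psum u n \<in> {a..<a + \<delta>}}) \<le> C"
proof -
  obtain \<delta> where \<delta>: "0 < \<delta>" "0 < emeasure P {u. u 0 < - \<delta>}"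
    using down_step_exists[OF assms] .
  define p where "p = measure P {u. u 0 < - \<delta>} * (1 - \<eta>)"
  have p: "emeasure P {u. u 0 < - \<delta>} * ennreal (1 - \<eta>) = ennreal p" "0 < p"
    using \<delta>(2) assms by (auto simp: p_def seq.P.emeasure_eq_measure simp flip: ennreal_mult)
  show thesis
  proof (rule that[OF \<delta>(1), of "ennreal (1 / p)"])
    fix a
    let ?s = "\<Sum>n. emeasure P {u. psum u n \<in> {a..<a + \<delta>}}"
    have *: "?s * ennreal p \<le> 1"
      using expected_visits_bound[of a \<delta>] by (simp only: p)
    show "?s \<le> ennreal (1 / p)"
    proof (cases ?s)
      case (real r)
      with * p(2) have "r * p \<le> 1" by (simp flip: ennreal_mult)
      with p(2) have "r \<le> 1 / p" by (simp add: field_simps)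
      with real show ?thesis by (simp add: ennreal_leI)
    next
      case top
      with * p(2) show ?thesis by (auto simp: ennreal_top_mult top_unique)
    qed
  qed simp
qed

end

lemma ennreal_le_suminf:
  fixes f :: "nat \<Rightarrow> ennreal"
  shows "f k \<le> (\<Sum>k. f k)"
  using sum_le_suminf[of f "{k}"] by simp

lemma suminf_indicator_multiples:
  assumes "0 < \<delta>" "0 \<le> x"
  shows "(\<Sum>k. indicator {k. real k * \<delta> \<le> x} k :: ennreal) \<le> ennreal (x / \<delta> + 1)"
proof -
  let ?K = "{k. real k * \<delta> \<le> x}"
  have K: "?K = {..nat \<lfloor>x / \<delta>\<rfloor>}"
    using assms by (auto simp: le_nat_iff le_floor_iff field_simps)
  have "(\<Sum>k. indicator ?K k :: ennreal) = (\<Sum>k\<in>?K. indicator ?K k)"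
    unfolding K by (intro suminf_finite) auto
  also have "\<dots> = ennreal (real (nat \<lfloor>x / \<delta>\<rfloor>) + 1)"
    unfolding K by (simp add: ennreal_of_nat_eq_real_of_nat add.commute)
  also have "\<dots> \<le> ennreal (x / \<delta> + 1)"
    using assms by (intro ennreal_leI) simp
  finally show ?thesis .
qed

text \<open>The number of multiples is at most \<open>x / \<delta> + 2\<close>, so the product is at
  most \<open>x ^ 3 / \<delta> + 2 * x\<^sup>2\<close>, and
  \<open>x\<^sup>2 \<le> x ^ 3 + 1\<close>. The extra power of \<open>x\<close> is the one moment
  that is lost.\<close>

lemma sq_times_multiples_le:
  assumes x: "0 \<le> x" and \<delta>: "0 < \<delta>"
  shows "ennreal (x\<^sup>2) * (\<Sum>k. indicator {k. real k * \<delta> \<le> x + \<delta>} k)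
    \<le> ennreal (1 / \<delta> + 2) * ennreal (x ^ 3) + 2"
proof -
    have "ennreal (x\<^sup>2) * (\<Sum>k. indicator {k. real k * \<delta> \<le> x + \<delta>} k) \<le> ennreal (x\<^sup>2) * ennreal ((x + \<delta>) / \<delta> + 1)"
      using x \<delta> by (intro mult_left_mono suminf_indicator_multiples) auto
    also have "\<dots> = ennreal (x\<^sup>2 * ((x + \<delta>) / \<delta> + 1))"
      using x \<delta> by (intro ennreal_mult[symmetric]) auto
    also have "\<dots> \<le> ennreal ((1 / \<delta> + 2) * x ^ 3 + 2)"
    proof (intro ennreal_leI)
      have "x\<^sup>2 \<le> x ^ 3 + 1"
      proof (cases "x \<le> 1")
        case True
        then have "x\<^sup>2 \<le> 1" using x by (simp add: power_le_one)
        moreover have "0 \<le> x ^ 3" using x by simp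
        ultimately show ?thesis by linarith
      next
        case False
        then have "x\<^sup>2 \<le> x ^ 3" by (intro power_increasing) auto
        then show ?thesis by simp
      qed
      then have "x ^ 3 / \<delta> + 2 * x\<^sup>2 \<le> x ^ 3 / \<delta> + 2 * (x ^ 3 + 1)" by simp
      moreover have "x\<^sup>2 * ((x + \<delta>) / \<delta> + 1) = x ^ 3 / \<delta> + 2 * x\<^sup>2"
        using \<delta> by (simp add: field_simps power2_eq_square power3_eq_cube)
      moreover have "x ^ 3 / \<delta> + 2 * (x ^ 3 + 1) = (1 / \<delta> + 2) * x ^ 3 + 2"
        by (simp add: algebra_simps)
      ultimately show "x\<^sup>2 * ((x + \<delta>) / \<delta> + 1) \<le> (1 / \<delta> + 2) * x ^ 3 + 2"
        by simp
    qed
    also have "\<dots> = ennreal ((1 / \<delta> + 2) * x ^ 3) + ennreal 2"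
      using x \<delta> by (intro ennreal_plus) auto
    also have "\<dots> = ennreal (1 / \<delta> + 2) * ennreal (x ^ 3) + 2"
      using x \<delta> by (subst ennreal_mult) auto
    finally show ?thesis .
qed

context iid_walk
begin

text \<open>At the first ladder epoch \<open>n + 1\<close> the walk comes from some \<open>psum u n \<le> 0\<close> by a step
  \<open>u n > - psum u n\<close> that is larger than the overshoot. Cutting the half-line into intervals of
  length \<open>\<delta>\<close> and bounding the number of visits to each of them costs one moment.\<close>

lemma integrable_first_height_sq:
  assumes \<eta>: "0 < \<eta>" "\<eta> < 1"
    and third: "(\<integral>\<^sup>+u. ennreal (max 0 (u 0) ^ 3) \<partial>P) < \<infinity>"
  shows "integrable P (\<lambda>u. indicator {u. ascends u} u * (first_height u)\<^sup>2)"
proof -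
  obtain \<delta> C where \<delta>: "0 < \<delta>" and C: "C < (\<infinity> :: ennreal)"
    "\<And>a. (\<Sum>n. emeasure P {u. psum u n \<in> {a..<a + \<delta>}}) \<le> C"
    using expected_visits_finite[OF \<eta>] by metis
  \<comment> \<open>From below \<open>- (real k * \<delta>) + \<delta>\<close> a step must exceed
    \<open>real k * \<delta> - \<delta>\<close> to reach the positive side; the indicator records
    this condition without reference to the exact position.\<close>
  define g :: "nat \<Rightarrow> (nat \<Rightarrow> real) \<Rightarrow> ennreal"
    where "g k u = ennreal ((max 0 (u 0))\<^sup>2) * indicator {k. real k * \<delta> \<le> max 0 (u 0) + \<delta>} k" for k u
  have [measurable]: "g k \<in> borel_measurable P" for k
    unfolding g_def indicator_def by measurable
  define I where "I k = {- (real k * \<delta>)..<- (real k * \<delta>) + \<delta>}" for k :: nat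
  have step: "ennreal (indicator {u. ascends u} u * (first_height u)\<^sup>2) \<le>
      (\<Sum>k. \<Sum>n. indicator {u. psum u n \<in> I k} u * g k (shift_seq n u))" for u
  proof (cases "ascends u")
    case True
    then obtain n where n: "hit u = Suc n"
      using psum_hit[OF True] by (cases "hit u") auto
    define x where "x = - psum u n"
    have x: "0 \<le> x" using psum_before_hit[of n u] n by (simp add: x_def)
    have h: "first_height u = u n - x" "0 < first_height u"
      using first_height_pos[OF True] by (auto simp: first_height_def n psum_Suc x_def)
    \<comment> \<open>Rounding up puts \<open>- x\<close> into the half-open interval
      \<open>I k\<close>; for \<open>x = 0\<close> this gives \<open>k = 0\<close>.\<close>
    define k where "k = nat \<lceil>x / \<delta>\<rceil>"
    have "real k = of_int \<lceil>x / \<delta>\<rceil>" using x \<delta> by (simp add: k_def)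
    then have "x / \<delta> \<le> real k" "real k < x / \<delta> + 1" by linarith+
    then have k: "x \<le> real k * \<delta>" "real k * \<delta> < x + \<delta>"
      using \<delta> by (auto simp: field_simps)
    have "(first_height u)\<^sup>2 \<le> (max 0 (u n))\<^sup>2"
      using h x by (intro power_mono) auto
    then have "ennreal (indicator {u. ascends u} u * (first_height u)\<^sup>2) \<le>
        indicator {u. psum u n \<in> I k} u * g k (shift_seq n u)"
      using True k h x \<delta> by (auto simp: g_def I_def indicator_def shift_seq_def x_def intro!: ennreal_leI)
    also have "\<dots> \<le> (\<Sum>n. indicator {u. psum u n \<in> I k} u * g k (shift_seq n u))"
      by (rule ennreal_le_suminf)
    also have "\<dots> \<le> (\<Sum>k. \<Sum>n. indicator {u. psum u n \<in> I k} u * g k (shift_seq n u))"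
      by (rule ennreal_le_suminf)
    finally show ?thesis .
  qed simp
  have "(\<integral>\<^sup>+u. ennreal (indicator {u. ascends u} u * (first_height u)\<^sup>2) \<partial>P) \<le>
      (\<integral>\<^sup>+u. (\<Sum>k. \<Sum>n. indicator {u. psum u n \<in> I k} u * g k (shift_seq n u)) \<partial>P)"
    by (intro nn_integral_mono step)
  also have "\<dots> = (\<Sum>k. \<integral>\<^sup>+u. (\<Sum>n. indicator {u. psum u n \<in> I k} u * g k (shift_seq n u)) \<partial>P)"
    unfolding I_def by (intro nn_integral_suminf) measurable
  also have "\<dots> = (\<Sum>k. \<Sum>n. \<integral>\<^sup>+u. indicator {u. psum u n \<in> I k} u * g k (shift_seq n u) \<partial>P)"
    unfolding I_def by (intro suminf_cong nn_integral_suminf) measurable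
  also have "\<dots> = (\<Sum>k. \<Sum>n. emeasure P {u. psum u n \<in> I k} * (\<integral>\<^sup>+u. g k u \<partial>P))"
  proof (intro suminf_cong)
    fix n k
    have [measurable]: "{u. psum u n \<in> I k} \<in> sets P" unfolding I_def by measurable
    \<comment> \<open>The position after \<open>n\<close> steps is independent of the next step, the
      only one that \<open>g k (shift_seq n u)\<close> reads.\<close>
    show "(\<integral>\<^sup>+u. indicator {u. psum u n \<in> I k} u * g k (shift_seq n u) \<partial>P) =
        emeasure P {u. psum u n \<in> I k} * (\<integral>\<^sup>+u. g k u \<partial>P)"
      using nn_integral_mult_split[of "indicator {u. psum u n \<in> I k}" "g k" n]
      by (simp add: indicator_def[of "{u. psum u n \<in> I k}" "comb_seq n _ _"] psum_comb_seq)
  qed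
  also have "\<dots> = (\<Sum>k. (\<Sum>n. emeasure P {u. psum u n \<in> I k}) * (\<integral>\<^sup>+u. g k u \<partial>P))"
    by simp
  also have "\<dots> \<le> (\<Sum>k. C * (\<integral>\<^sup>+u. g k u \<partial>P))"
    unfolding I_def by (intro suminf_le mult_right_mono C) auto
  also have "\<dots> = C * (\<integral>\<^sup>+u. (\<Sum>k. g k u) \<partial>P)"
    by (simp add: nn_integral_suminf)
  also have "\<dots> \<le> C * (\<integral>\<^sup>+u. ennreal (1 / \<delta> + 2) * ennreal (max 0 (u 0) ^ 3) + 2 \<partial>P)"
  proof (intro mult_left_mono nn_integral_mono)
    fix u :: "nat \<Rightarrow> real"
    show "(\<Sum>k. g k u) \<le> ennreal (1 / \<delta> + 2) * ennreal (max 0 (u 0) ^ 3) + 2"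
      using sq_times_multiples_le[of "max 0 (u 0)" \<delta>] \<delta> by (simp add: g_def)
  qed simp
  also have "\<dots> = C * (ennreal (1 / \<delta> + 2) * (\<integral>\<^sup>+u. ennreal (max 0 (u 0) ^ 3) \<partial>P) + 2)"
    by (simp add: nn_integral_add nn_integral_cmult seq.P.emeasure_space_1[simplified])
  also have "\<dots> < \<infinity>"
    using C(1) third by (simp add: ennreal_mult_less_top)
  finally show ?thesis
    by (intro integrableI_nonneg) auto
qed

lemma integrable_first_height:
  assumes "integrable P (\<lambda>u. indicator {u. ascends u} u * (first_height u)\<^sup>2)"
  shows "integrable P (\<lambda>u. indicator {u. ascends u} u * first_height u)"
proof (rule Bochner_Integration.integrable_bound)
  show "integrable P (\<lambda>u. 1 + indicator {u. ascends u} u * (first_height u)\<^sup>2)"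
    using assms by simp
  have "\<bar>y\<bar> \<le> 1 + y\<^sup>2" for y :: real
    using zero_le_power2[of "\<bar>y\<bar> - 1"] by (simp add: power2_diff)
  then show "AE u in P. norm (indicator {u. ascends u} u * first_height u)
      \<le> norm (1 + indicator {u. ascends u} u * (first_height u)\<^sup>2)"
    by (intro AE_I2) (simp add: indicator_def)
qed measurable

end

section \<open>Stein's equation for the exponential law\<close>

text \<open>Linear growth \<open>\<bar>h t\<bar> \<le> \<bar>h 0\<bar> + t\<close> reduces the claim
  to the Gamma integrals with exponents 0 and 1.\<close>

lemma integrable_exp_lipschitz:
  fixes h :: "real \<Rightarrow> real"
  assumes h: "1-lipschitz_on UNIV h"
  shows "integrable lborel (\<lambda>t. indicator {0..} t * (h t * exp (- t)))"
proof (rule Bochner_Integration.integrable_bound)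
  have int: "integrable lborel (\<lambda>t::real. indicator {0..} t * (t ^ k * exp (- t)))" for k
  proof (rule integrableI_nonneg)
    have "(\<integral>\<^sup>+t. ennreal (indicator {0..} t * (t ^ k * exp (- t))) \<partial>lborel) =
        (\<integral>\<^sup>+t. ennreal (t ^ k * exp (- t)) * indicator {0..} t \<partial>lborel)"
      by (intro nn_integral_cong) (auto simp: indicator_def)
    also have "\<dots> < \<infinity>"
      unfolding nn_intergal_power_times_exp_Ici by simp
    finally show "(\<integral>\<^sup>+t. ennreal (indicator {0..} t * (t ^ k * exp (- t))) \<partial>lborel) < \<infinity>" .
  qed (auto simp: indicator_def)
  show "integrable lborel (\<lambda>t. \<bar>h 0\<bar> * (indicator {0..} t * (t ^ 0 * exp (- t))) + indicator {0..} t * (t ^ 1 * exp (- t)))"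
    by (intro Bochner_Integration.integrable_add integrable_mult_right int)
  have "continuous_on UNIV h" using h by (rule lipschitz_on_continuous_on)
  then have [measurable]: "h \<in> borel_measurable borel"
    by (rule borel_measurable_continuous_onI)
  show "(\<lambda>t. indicator {0..} t * (h t * exp (- t))) \<in> borel_measurable lborel"
    by measurable
  have "\<bar>h t\<bar> \<le> \<bar>h 0\<bar> + t" if "0 \<le> t" for t
    using lipschitz_onD[OF h, of t 0] that by (simp add: dist_real_def)
  then have "\<bar>h t * exp (- t)\<bar> \<le> \<bar>h 0\<bar> * exp (- t) + t * exp (- t)" if "0 \<le> t" for t
    using mult_right_mono[of "\<bar>h t\<bar>" "\<bar>h 0\<bar> + t" "exp (- t)"] that by (simp add: abs_mult distrib_right)
  then show "AE t in lborel. norm (indicator {0..} t * (h t * exp (- t))) \<le>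
      norm (\<bar>h 0\<bar> * (indicator {0..} t * (t ^ 0 * exp (- t))) + indicator {0..} t * (t ^ 1 * exp (- t)))"
    by (intro AE_I2) (simp add: indicator_def)
qed

lemma set_integral_exp_law:
  fixes h :: "real \<Rightarrow> real"
  assumes [measurable]: "h \<in> borel_measurable borel"
  shows "(LINT x:{0..}|exp_law 1. h x) = (\<integral>t. indicator {0..} t * (h t * exp (- t)) \<partial>lborel)"
  unfolding set_lebesgue_integral_def exp_law_def
  by (subst integral_density)
     (auto intro!: Bochner_Integration.integral_cong simp: exponential_density_def indicator_def)

text \<open>\<open>g\<close> is the resolvent \<open>g x = E h (x + Z)\<close> of the exponential law, written as
  \<open>exp x\<close> times the tail integral of \<open>h t * exp (- t)\<close>.\<close>

lemma stein_equation_exp: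
  fixes h :: "real \<Rightarrow> real"
  assumes h: "1-lipschitz_on UNIV h"
  obtains g where "\<And>x. (g has_real_derivative g x - h x) (at x)"
    "\<And>x. 0 \<le> x \<Longrightarrow> \<bar>g x - h x\<bar> \<le> 1"
    "g 0 = (LINT x:{0..}|exp_law 1. h x)"
proof -
  have "continuous_on UNIV h" using h by (rule lipschitz_on_continuous_on)
  then have cont: "isCont h x" for x
    by (simp add: continuous_on_eq_continuous_at)
  have [measurable]: "h \<in> borel_measurable borel"
    using \<open>continuous_on UNIV h\<close> by (rule borel_measurable_continuous_onI)
  have "\<exists>F. \<forall>x::real. - \<infinity> < ereal x \<longrightarrow> ereal x < \<infinity> \<longrightarrow>
      (F has_vector_derivative h x * exp (- x)) (at x)"
    by (intro einterval_antiderivative) (auto intro!: continuous_intros cont)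
  then obtain F where F: "(F has_real_derivative h x * exp (- x)) (at x)" for x
    by (auto simp: has_real_derivative_iff_has_vector_derivative)
  define C where "C = (\<integral>t. indicator {0..} t * (h t * exp (- t)) \<partial>lborel)"
  \<comment> \<open>The antiderivative \<open>F\<close> is arbitrary up to a constant;
    \<open>C + F 0\<close> turns out to be its limit at infinity.\<close>
  define g where "g x = exp x * (C + F 0 - F x)" for x
  have lim: "(F \<longlongrightarrow> C + F 0) at_top"
  proof -
    have "((\<lambda>y. \<integral>t. indicator {..y} t *\<^sub>R (indicator {0..} t * (h t * exp (- t))) \<partial>lborel) \<longlongrightarrow> C) at_top"
      unfolding C_def by (intro tendsto_integral_at_top integrable_exp_lipschitz h) simp
    moreover have "(\<integral>t. indicator {..y} t *\<^sub>R (indicator {0..} t * (h t * exp (- t))) \<partial>lborel) = F y - F 0"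
      if "0 \<le> y" for y
    proof -
      have "(\<integral>t. indicator {..y} t *\<^sub>R (indicator {0..} t * (h t * exp (- t))) \<partial>lborel) =
          (\<integral>t. (h t * exp (- t)) * indicator {0..y} t \<partial>lborel)"
        by (intro Bochner_Integration.integral_cong) (auto simp: indicator_def)
      also have "\<dots> = F y - F 0"
        using that F by (intro integral_FTC_Icc_real) (auto intro!: continuous_intros cont)
      finally show ?thesis .
    qed
    then have "eventually (\<lambda>y. (\<integral>t. indicator {..y} t *\<^sub>R (indicator {0..} t * (h t * exp (- t))) \<partial>lborel) = F y - F 0) at_top"
      using eventually_ge_at_top[of "0::real"] by (rule eventually_mono[rotated])
    ultimately have "((\<lambda>y. F y - F 0) \<longlongrightarrow> C) at_top"
      by (rule Lim_transform_eventually)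
    then have "((\<lambda>y. (F y - F 0) + F 0) \<longlongrightarrow> C + F 0) at_top"
      by (intro tendsto_intros)
    then show ?thesis by simp
  qed
  show thesis
  proof (rule that[of g])
    fix x
    show "(g has_real_derivative g x - h x) (at x)"
      unfolding g_def
      by (auto intro!: derivative_eq_intros F simp: exp_minus field_simps)
  next
    fix x :: real assume "0 \<le> x"
    have tail: "((\<lambda>t. exp (- t) * (c + t)) \<longlongrightarrow> 0) at_top" for c :: real
    proof -
      have "((\<lambda>t::real. c * (t ^ 0 / exp t) + t ^ 1 / exp t) \<longlongrightarrow> c * 0 + 0) at_top"
        by (intro tendsto_intros tendsto_power_div_exp_0)
      then show ?thesis by (simp add: exp_minus field_simps)
    qed
    \<comment> \<open>This is E h(x + Z) - h x \<le> E Z = 1 and its mirror image, \<open>s\<close>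
      being the sign. Instead of integrating, \<open>\<Phi>\<close> compares \<open>s * F\<close>
      with an antiderivative of \<open>exp (- t) * (s * h x + (t - x))\<close>: it decreases by the
      Lipschitz property, and its limit at infinity is read off from \<open>lim\<close>.\<close>
    have upper: "s * (C + F 0 - F x) \<le> exp (- x) * (s * h x + 1)" if s: "s \<in> {1, -1}" for s
    proof -
      define \<Phi> where "\<Phi> t = s * F t + exp (- t) * (s * h x + 1 - x + t)" for t
      have "\<Phi> t \<le> \<Phi> x" if "x \<le> t" for t
        using that
      proof (rule DERIV_nonpos_imp_nonincreasing)
        fix u assume u: "x \<le> u" "u \<le> t"
        have "(\<Phi> has_real_derivative exp (- u) * (s * (h u - h x) - (u - x))) (at u)"
          unfolding \<Phi>_def by (auto intro!: derivative_eq_intros F simp: algebra_simps)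
        moreover have "s * (h u - h x) \<le> u - x"
          using lipschitz_onD[OF h, of u x] u s by (auto simp: dist_real_def)
        ultimately show "\<exists>y. (\<Phi> has_real_derivative y) (at u) \<and> y \<le> 0"
          by (intro exI[of _ "exp (- u) * (s * (h u - h x) - (u - x))"])
             (auto intro!: mult_nonneg_nonpos)
      qed
      then have "eventually (\<lambda>t. \<Phi> t \<le> \<Phi> x) at_top"
        using eventually_ge_at_top[of x] by (rule eventually_mono[rotated])
      moreover have "(\<Phi> \<longlongrightarrow> s * (C + F 0) + 0) at_top"
        unfolding \<Phi>_def by (intro tendsto_intros lim tail)
      ultimately have "s * (C + F 0) + 0 \<le> \<Phi> x"
        by (intro tendsto_upperbound) auto
      then show ?thesis by (simp add: \<Phi>_def algebra_simps)
    qed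
    have "s * (g x - h x) \<le> 1" if "s \<in> {1, -1}" for s
    proof -
      have "exp x * (s * (C + F 0 - F x)) \<le> exp x * (exp (- x) * (s * h x + 1))"
        using upper[OF that] by (intro mult_left_mono) auto
      also have "\<dots> = s * h x + 1" by (simp add: exp_minus)
      finally show ?thesis by (simp add: g_def algebra_simps)
    qed
    from this[of 1] this[of "-1"] show "\<bar>g x - h x\<bar> \<le> 1" by simp
  next
    show "g 0 = (LINT x:{0..}|exp_law 1. h x)"
      by (simp add: g_def C_def set_integral_exp_law)
  qed
qed

text \<open>The second derivative of \<open>g\<close> need not exist, since \<open>h\<close> is only
  Lipschitz. The derivative \<open>g - h\<close> changes by at most 2t over a distance t;
  integrating this gives \<open>y\<^sup>2\<close>, here through the monotonicity of an auxiliary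
  function for each sign \<open>s\<close>.\<close>

lemma stein_exp_taylor:
  fixes g h :: "real \<Rightarrow> real"
  assumes h: "1-lipschitz_on UNIV h"
    and g: "\<And>x. (g has_real_derivative g x - h x) (at x)"
    and bound: "\<And>x. 0 \<le> x \<Longrightarrow> \<bar>g x - h x\<bar> \<le> 1"
    and "0 \<le> w" "0 \<le> y"
  shows "\<bar>g (w + y) - g w - y * (g w - h w)\<bar> \<le> y\<^sup>2"
proof -
  have lip: "s * (g (w + t) - g w) \<le> t" if "0 \<le> t" "s \<in> {1, -1}" for s t
  proof -
    have "0 - s * (g (w + 0) - g w) \<le> t - s * (g (w + t) - g w)"
      using that(1)
    proof (rule DERIV_nonneg_imp_nondecreasing[of 0 t "\<lambda>t. t - s * (g (w + t) - g w)"])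
      fix u assume u: "0 \<le> u" "u \<le> t"
      have "((\<lambda>t. t - s * (g (w + t) - g w)) has_real_derivative 1 - s * (g (w + u) - h (w + u))) (at u)"
        by (auto intro!: derivative_eq_intros DERIV_chain'[of _ _ _ _ g, OF _ g])
      moreover have "s * (g (w + u) - h (w + u)) \<le> 1"
        using bound[of "w + u"] u \<open>0 \<le> w\<close> that(2) by auto
      ultimately show "\<exists>y. ((\<lambda>t. t - s * (g (w + t) - g w)) has_real_derivative y) (at u) \<and> 0 \<le> y"
        by (intro exI[of _ "1 - s * (g (w + u) - h (w + u))"]) auto
    qed
    then show ?thesis by simp
  qed
  let ?c = "g w - h w"
  have "s * (g (w + y) - g w - y * ?c) \<le> y\<^sup>2" if s: "s \<in> {1, -1}" for s
  proof -
    let ?\<phi> = "\<lambda>t. t\<^sup>2 - s * (g (w + t) - g w - t * ?c)"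
    have "?\<phi> 0 \<le> ?\<phi> y"
      using \<open>0 \<le> y\<close>
    proof (rule DERIV_nonneg_imp_nondecreasing)
      fix u assume u: "0 \<le> u" "u \<le> y"
      have "(?\<phi> has_real_derivative 2 * u - s * (g (w + u) - h (w + u) - ?c)) (at u)"
        by (auto intro!: derivative_eq_intros DERIV_chain'[of _ _ _ _ g, OF _ g])
      \<comment> \<open>One \<open>u\<close> comes from \<open>g\<close>, whose derivative is at
        most 1 in absolute value on the half-line, and one from \<open>h\<close>.\<close>
      moreover have "s * (g (w + u) - h (w + u) - ?c) \<le> 2 * u"
        using lip[OF u(1) s] lipschitz_onD[OF h, of "w + u" w] s u by (auto simp: dist_real_def)
      ultimately show "\<exists>y. (?\<phi> has_real_derivative y) (at u) \<and> 0 \<le> y"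
        by (intro exI[of _ "2 * u - s * (g (w + u) - h (w + u) - ?c)"]) auto
    qed
    then show ?thesis by simp
  qed
  from this[of 1] this[of "-1"] show ?thesis by simp
qed

lemma (in pair_sigma_finite)
  fixes F :: "'a \<Rightarrow> real" and k :: "'b \<Rightarrow> real"
  assumes F: "integrable M1 F" and k: "integrable M2 k"
  shows integrable_tensor: "integrable (M1 \<Otimes>\<^sub>M M2) (\<lambda>(x, y). F x * k y)"
    and integral_tensor: "(\<integral>(x, y). F x * k y \<partial>(M1 \<Otimes>\<^sub>M M2)) = (\<integral>x. F x \<partial>M1) * (\<integral>y. k y \<partial>M2)"
proof -
  have [measurable]: "F \<in> borel_measurable M1" "k \<in> borel_measurable M2"
    using F k by auto
  show int: "integrable (M1 \<Otimes>\<^sub>M M2) (\<lambda>(x, y). F x * k y)"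
  proof (rule Fubini_integrable)
    have "integrable M1 (\<lambda>x. \<bar>F x\<bar> * (\<integral>y. \<bar>k y\<bar> \<partial>M2))"
      using F by simp
    then show "integrable M1 (\<lambda>x. \<integral>y. norm (case (x, y) of (x, y) \<Rightarrow> F x * k y) \<partial>M2)"
      by (simp add: abs_mult)
  qed (use k in auto)
  show "(\<integral>(x, y). F x * k y \<partial>(M1 \<Otimes>\<^sub>M M2)) = (\<integral>x. F x \<partial>M1) * (\<integral>y. k y \<partial>M2)"
    using integral_fst[of "\<lambda>x y. F x * k y"] int by simp
qed

context iid_walk
begin

sublocale PP: pair_sigma_finite P P ..

lemma mean_first_height_pos:
  assumes "0 < \<eta>" and int: "integrable P (\<lambda>u. indicator {u. ascends u} u * first_height u)"
  shows "0 < (\<integral>u. indicator {u. ascends u} u * first_height u \<partial>P)"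
proof -
  let ?f = "\<lambda>u. indicator {u. ascends u} u * first_height u"
  have nonneg: "0 \<le> ?f u" for u
    using first_height_pos[of u] by (auto simp: indicator_def less_imp_le)
  have "integral\<^sup>L P ?f \<noteq> 0"
  proof
    assume "integral\<^sup>L P ?f = 0"
    then have "AE u in P. ?f u = 0"
      using nonneg by (subst (asm) integral_nonneg_eq_0_iff_AE[OF int]) auto
    then have "AE u in P. \<not> ascends u"
      by eventually_elim (auto dest: first_height_pos)
    then have "emeasure P {u. ascends u} = 0"
      by (subst (asm) AE_iff_measurable[OF _ refl]) auto
    with assms(1) show False by (simp add: seq.P.emeasure_eq_measure)
  qed
  moreover have "0 \<le> integral\<^sup>L P ?f"
    using nonneg by (intro Bochner_Integration.integral_nonneg) auto
  ultimately show ?thesis by simp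
qed

text \<open>The integral in \<open>a\<close> runs over the ladder event without conditioning, so it
  equals \<eta> times the conditional mean and \<open>a\<close> is the scale of the rescaled waiting
  time.\<close>

lemma stein_bound_walk_sup:
  fixes h :: "real \<Rightarrow> real"
  assumes \<eta>: "0 < \<eta>" "\<eta> < 1"
    and sq: "integrable P (\<lambda>u. indicator {u. ascends u} u * (first_height u)\<^sup>2)"
    and h: "1-lipschitz_on UNIV h"
  defines "a \<equiv> (1 - \<eta>) / (\<integral>u. indicator {u. ascends u} u * first_height u \<partial>P)"
  shows "\<bar>(\<integral>u. h (a * walk_sup u) \<partial>P) - (LINT x:{0..}|exp_law 1. h x)\<bar> \<le>
    a\<^sup>2 * (\<integral>u. indicator {u. ascends u} u * (first_height u)\<^sup>2 \<partial>P) / (1 - \<eta>)"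
proof -
  let ?A = "{u. ascends u}"
  define m where "m = (\<integral>u. indicator ?A u * first_height u \<partial>P)"
  have int1: "integrable P (\<lambda>u. indicator ?A u * first_height u)"
    using integrable_first_height[OF sq] .
  have "0 < m" unfolding m_def using mean_first_height_pos[OF \<eta>(1) int1] .
  have am: "a * m = 1 - \<eta>" "0 < a"
    using \<open>0 < m\<close> \<eta> by (auto simp: a_def m_def[symmetric])
  have nonneg: "AE u in P. 0 \<le> walk_sup u"
    using AE_attains_max[OF \<eta>(2)] by eventually_elim (rule walk_sup_nonneg)
  have W: "integrable P walk_sup"
    using integrable_walk_sup[OF \<eta>(2) int1] .
  obtain g where g: "\<And>x. (g has_real_derivative g x - h x) (at x)"
    "\<And>x. 0 \<le> x \<Longrightarrow> \<bar>g x - h x\<bar> \<le> 1"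
    "g 0 = (LINT x:{0..}|exp_law 1. h x)"
    using stein_equation_exp[OF h] by metis
  have [measurable]: "h \<in> borel_measurable borel"
    using lipschitz_on_continuous_on[OF h] by (rule borel_measurable_continuous_onI)
  have [measurable]: "g \<in> borel_measurable borel"
    using g(1) by (intro borel_measurable_continuous_onI continuous_at_imp_continuous_on) (auto intro: DERIV_isCont)
  define g' where "g' x = g x - h x" for x
  have [measurable]: "g' \<in> borel_measurable borel" unfolding g'_def by measurable
  have h_bound: "\<bar>h x\<bar> \<le> \<bar>h 0\<bar> + \<bar>x\<bar>" for x
    using lipschitz_onD[OF h, of x 0] by (simp add: dist_real_def)
  have inth: "integrable P (\<lambda>u. h (a * walk_sup u))"
    by (rule Bochner_Integration.integrable_bound[of _ "\<lambda>u. \<bar>h 0\<bar> + \<bar>a * walk_sup u\<bar>"])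
       (use W h_bound in \<open>auto intro!: AE_I2\<close>)
  have intg': "integrable P (\<lambda>u. g' (a * walk_sup u))"
  proof (rule seq.P.integrable_const_bound[of _ 1])
    show "AE u in P. norm (g' (a * walk_sup u)) \<le> 1"
      using nonneg by eventually_elim (use am(2) in \<open>auto simp: g'_def intro!: g(2)\<close>)
  qed measurable
  have intg: "integrable P (\<lambda>u. g (a * walk_sup u))"
    using Bochner_Integration.integrable_add[OF intg' inth] by (simp add: g'_def)
  have intA: "integrable P (indicator ?A :: _ \<Rightarrow> real)"
    by (simp add: seq.P.emeasure_eq_measure)
  define T1 :: "(nat \<Rightarrow> real) \<times> (nat \<Rightarrow> real) \<Rightarrow> real" where
    "T1 = (\<lambda>(u, v). g (a * (if ascends u then first_height u + walk_sup v else 0)))"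
  define T2 :: "(nat \<Rightarrow> real) \<times> (nat \<Rightarrow> real) \<Rightarrow> real" where
    "T2 = (\<lambda>(u, v). indicator {u. \<not> ascends u} u * g 0)"
  define T3 :: "(nat \<Rightarrow> real) \<times> (nat \<Rightarrow> real) \<Rightarrow> real" where
    "T3 = (\<lambda>(u, v). indicator ?A u * g (a * walk_sup v))"
  define T4 :: "(nat \<Rightarrow> real) \<times> (nat \<Rightarrow> real) \<Rightarrow> real" where
    "T4 = (\<lambda>(u, v). (a * (indicator ?A u * first_height u)) * g' (a * walk_sup v))"
  \<comment> \<open>\<open>T1\<close> is \<open>g\<close> at the right-hand side of the fixed point
    equation, \<open>T2\<close> its value without ascent, \<open>T3\<close> and \<open>T4\<close>
    the Taylor terms of order zero and one. Without ascent the difference vanishes; with ascent it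
    is the Taylor remainder.\<close>
  let ?T = "\<lambda>z. T1 z - T2 z - T3 z - T4 z"
  have int_T1: "integrable (P \<Otimes>\<^sub>M P) T1" "(\<integral>u. g (a * walk_sup u) \<partial>P) = integral\<^sup>L (P \<Otimes>\<^sub>M P) T1"
    unfolding T1_def
    using integrable_walk_sup_step[OF \<eta>(2), of "\<lambda>x. g (a * x)"] integral_walk_sup_step[OF \<eta>(2), of "\<lambda>x. g (a * x)"] intg
    by auto
  have int_T2: "integrable (P \<Otimes>\<^sub>M P) T2" "integral\<^sup>L (P \<Otimes>\<^sub>M P) T2 = (1 - \<eta>) * g 0"
    unfolding T2_def
    using PP.integrable_tensor[of "indicator {u. \<not> ascends u}" "\<lambda>_. g 0"]
      PP.integral_tensor[of "indicator {u. \<not> ascends u}" "\<lambda>_. g 0"]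
    by (auto simp: seq.P.emeasure_eq_measure measure_not_ascends seq.P.prob_space[simplified])
  have int_T3: "integrable (P \<Otimes>\<^sub>M P) T3" "integral\<^sup>L (P \<Otimes>\<^sub>M P) T3 = \<eta> * (\<integral>u. g (a * walk_sup u) \<partial>P)"
    unfolding T3_def
    using PP.integrable_tensor[OF intA intg] PP.integral_tensor[OF intA intg] by auto
  have int_T4: "integrable (P \<Otimes>\<^sub>M P) T4"
      "integral\<^sup>L (P \<Otimes>\<^sub>M P) T4 = (1 - \<eta>) * (\<integral>u. g' (a * walk_sup u) \<partial>P)"
    unfolding T4_def
    using PP.integrable_tensor[OF integrable_mult_right[OF int1] intg', of a]
      PP.integral_tensor[OF integrable_mult_right[OF int1] intg', of a] am
    by (simp_all add: m_def)
  have intT: "integrable (P \<Otimes>\<^sub>M P) ?T"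
    using int_T1(1) int_T2(1) int_T3(1) int_T4(1) by (intro Bochner_Integration.integrable_diff)
  have Eh: "(\<integral>u. h (a * walk_sup u) \<partial>P) = (\<integral>u. g (a * walk_sup u) \<partial>P) - (\<integral>u. g' (a * walk_sup u) \<partial>P)"
    using Bochner_Integration.integral_diff[OF intg intg'] by (simp add: g'_def)
  have ET: "integral\<^sup>L (P \<Otimes>\<^sub>M P) ?T = (\<integral>u. g (a * walk_sup u) \<partial>P) - (1 - \<eta>) * g 0
      - \<eta> * (\<integral>u. g (a * walk_sup u) \<partial>P) - (1 - \<eta>) * (\<integral>u. g' (a * walk_sup u) \<partial>P)"
    using int_T1 int_T2 int_T3 int_T4 by (simp add: Bochner_Integration.integral_diff Bochner_Integration.integrable_diff)
  have eq: "(1 - \<eta>) * ((\<integral>u. h (a * walk_sup u) \<partial>P) - g 0) = integral\<^sup>L (P \<Otimes>\<^sub>M P) ?T"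
    unfolding Eh ET by (simp only: algebra_simps)
  let ?b = "\<lambda>(u, v). (a\<^sup>2 * (indicator ?A u * (first_height u)\<^sup>2)) * 1"
  have b: "integrable (P \<Otimes>\<^sub>M P) ?b"
      "integral\<^sup>L (P \<Otimes>\<^sub>M P) ?b = a\<^sup>2 * (\<integral>u. indicator ?A u * (first_height u)\<^sup>2 \<partial>P)"
    using PP.integrable_tensor[OF integrable_mult_right[OF sq], of "\<lambda>_. 1" "a\<^sup>2"]
      PP.integral_tensor[OF integrable_mult_right[OF sq], of "\<lambda>_. 1" "a\<^sup>2"]
    by (simp_all add: seq.P.prob_space[simplified])
  have "AE z in P \<Otimes>\<^sub>M P. \<bar>?T z\<bar> \<le> ?b z"
  proof -
    have [measurable]: "T1 \<in> borel_measurable (P \<Otimes>\<^sub>M P)" "T2 \<in> borel_measurable (P \<Otimes>\<^sub>M P)"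
      "T3 \<in> borel_measurable (P \<Otimes>\<^sub>M P)" "T4 \<in> borel_measurable (P \<Otimes>\<^sub>M P)"
      using int_T1 int_T2 int_T3 int_T4 by auto
    have "AE u in P. AE v in P. \<bar>?T (u, v)\<bar> \<le> ?b (u, v)"
    proof (rule AE_I2)
      fix u
      from nonneg show "AE v in P. \<bar>?T (u, v)\<bar> \<le> ?b (u, v)"
      proof (eventually_elim, goal_cases)
        case v: (1 v)
        show ?case
        proof (cases "ascends u")
          case True
          have "\<bar>g (a * walk_sup v + a * first_height u) - g (a * walk_sup v)
              - (a * first_height u) * (g (a * walk_sup v) - h (a * walk_sup v))\<bar> \<le> (a * first_height u)\<^sup>2"
            using am(2) v first_height_pos[OF True] by (intro stein_exp_taylor[OF h g(1,2)]) auto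
          with True show ?thesis
            by (simp add: T1_def T2_def T3_def T4_def g'_def power_mult_distrib algebra_simps)
        qed (simp add: T1_def T2_def T3_def T4_def)
      qed
    qed
    then show ?thesis
      by (intro PP.AE_pair_measure) measurable
  qed
  then have "\<bar>integral\<^sup>L (P \<Otimes>\<^sub>M P) ?T\<bar> \<le> integral\<^sup>L (P \<Otimes>\<^sub>M P) ?b"
    using integral_norm_bound[of "P \<Otimes>\<^sub>M P" ?T] integral_mono_AE[OF integrable_norm[OF intT] b(1)]
    by (simp only: real_norm_def) (erule order_trans, simp)
  with b eq have "(1 - \<eta>) * \<bar>(\<integral>u. h (a * walk_sup u) \<partial>P) - g 0\<bar> \<le>
      a\<^sup>2 * (\<integral>u. indicator ?A u * (first_height u)\<^sup>2 \<partial>P)"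
    using \<eta>(2) by (simp add: abs_mult flip: eq)
  with \<eta>(2) show ?thesis
    by (simp add: g(3) field_simps)
qed

text \<open>Test functions are constrained on the half-line only, while the Stein equation is solved
  on the whole line. Extending by the constant \<open>h 0\<close> to the left keeps the Lipschitz
  constant and all integrals over \<open>{0..}\<close>.\<close>

lemma lipschitz_on_max_0:
  fixes h :: "real \<Rightarrow> real"
  assumes "L-lipschitz_on {0..} h"
  shows "L-lipschitz_on UNIV (\<lambda>x. h (max 0 x))"
proof (rule lipschitz_onI)
  fix x y :: real
  have "dist (h (max 0 x)) (h (max 0 y)) \<le> L * dist (max 0 x) (max 0 y)"
    by (rule lipschitz_onD[OF assms]) auto
  also have "\<dots> \<le> L * dist x y"
    using lipschitz_on_nonneg[OF assms] by (intro mult_left_mono) (auto simp: dist_real_def)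
  finally show "dist (h (max 0 x)) (h (max 0 y)) \<le> L * dist x y" .
qed (rule lipschitz_on_nonneg[OF assms])

lemma wasserstein_walk_sup:
  assumes \<eta>: "0 < \<eta>" "\<eta> < 1"
    and sq: "integrable P (\<lambda>u. indicator {u. ascends u} u * (first_height u)\<^sup>2)"
  defines "a \<equiv> (1 - \<eta>) / (\<integral>u. indicator {u. ascends u} u * first_height u \<partial>P)"
  shows "wasserstein_dist (distr P borel (\<lambda>u. a * walk_sup u)) (exp_law 1) \<le>
    ereal (a\<^sup>2 * (\<integral>u. indicator {u. ascends u} u * (first_height u)\<^sup>2 \<partial>P) / (1 - \<eta>))"
  unfolding wasserstein_dist_def
proof (rule SUP_least)
  fix h :: "real \<Rightarrow> real" assume "h \<in> {h. 1-lipschitz_on {0..} h}"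
  define h' where "h' x = h (max 0 x)" for x
  have h': "1-lipschitz_on UNIV h'"
    using \<open>h \<in> _\<close> unfolding h'_def by (auto intro: lipschitz_on_max_0)
  have [measurable]: "h' \<in> borel_measurable borel"
    using lipschitz_on_continuous_on[OF h'] by (rule borel_measurable_continuous_onI)
  have eq: "(LINT x:{0..}|N. h x) = (LINT x:{0..}|N. h' x)" for N
    unfolding set_lebesgue_integral_def
    by (intro Bochner_Integration.integral_cong) (auto simp: h'_def indicator_def)
  have "0 < a"
    unfolding a_def using \<eta> mean_first_height_pos[OF \<eta>(1) integrable_first_height[OF sq]] by simp
  have "(LINT x:{0..}|distr P borel (\<lambda>u. a * walk_sup u). h' x) =
      (\<integral>u. indicator {0..} (a * walk_sup u) *\<^sub>R h' (a * walk_sup u) \<partial>P)"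
    unfolding set_lebesgue_integral_def by (intro integral_distr) measurable
  also have "\<dots> = (\<integral>u. h' (a * walk_sup u) \<partial>P)"
  proof (intro integral_cong_AE)
    show "AE u in P. indicator {0..} (a * walk_sup u) *\<^sub>R h' (a * walk_sup u) = h' (a * walk_sup u)"
      using AE_attains_max[OF \<eta>(2)]
      by eventually_elim (use \<open>0 < a\<close> in \<open>auto dest: walk_sup_nonneg\<close>)
  qed measurable
  finally show "ereal \<bar>(LINT x:{0..}|distr P borel (\<lambda>u. a * walk_sup u). h x) - (LINT x:{0..}|exp_law 1. h x)\<bar>
      \<le> ereal (a\<^sup>2 * (\<integral>u. indicator {u. ascends u} u * (first_height u)\<^sup>2 \<partial>P) / (1 - \<eta>))"
    using stein_bound_walk_sup[OF \<eta> sq h'] by (simp add: eq a_def)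
qed

end

section \<open>The queue\<close>

text \<open>Entry 0 is \<open>S 1 - X 2\<close>: the queue numbers its customers from 1, the path
  its steps from 0.\<close>

definition increments ::
    "(nat \<Rightarrow> 'a \<Rightarrow> real) \<Rightarrow> (nat \<Rightarrow> 'a \<Rightarrow> real) \<Rightarrow> 'a \<Rightarrow> nat \<Rightarrow> real" where
  "increments S X \<omega> j = S (Suc j) \<omega> - X (Suc (Suc j)) \<omega>"

lemma walk_eq_psum: "walk S X n \<omega> = psum (increments S X \<omega>) n"
  by (simp add: walk_def psum_def increments_def sum.atLeast_Suc_atMost_Suc_shift atLeast0LessThan
      sum.atLeast1_atMost_eq)

lemma waiting_time_eq_walk_sup: "waiting_time S X \<omega> = walk_sup (increments S X \<omega>)"
  by (simp add: waiting_time_def walk_sup_def walk_eq_psum)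

lemma first_ladder_epoch:
  "ladder_epoch (\<lambda>i. walk S X i \<omega>) 1 =
    (if ascends (increments S X \<omega>) then enat (hit (increments S X \<omega>)) else \<infinity>)"
proof -
  let ?u = "increments S X \<omega>"
  let ?I = "{i. 0 < psum ?u i}"
  have I: "{i. (0::enat) < enat i \<and> walk S X (the_enat 0) \<omega> < walk S X i \<omega>} = ?I"
    by (auto simp: walk_eq_psum zero_enat_def intro: Nat.gr0I)
  have epoch: "ladder_epoch (\<lambda>i. walk S X i \<omega>) 1 = (INF i \<in> ?I. enat i)"
    by (simp only: One_nat_def ladder_epoch.simps I)
  show ?thesis
  proof (cases "ascends ?u")
    case True
    have "(INF i \<in> ?I. enat i) = enat (hit ?u)"
    proof (rule antisym)
      show "(INF i \<in> ?I. enat i) \<le> enat (hit ?u)"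
        using psum_hit[OF True] by (intro INF_lower) simp
      show "enat (hit ?u) \<le> (INF i \<in> ?I. enat i)"
        by (intro INF_greatest) (auto simp: hit_def intro: Least_le)
    qed
    with True epoch show ?thesis by simp
  next
    case False
    then have "?I = {}" by (auto simp: ascends_def)
    with False epoch show ?thesis by (simp add: top_enat_def)
  qed
qed

lemma finite_ladder_event_eq:
  "finite_ladder_event M S X = {\<omega> \<in> space M. ascends (increments S X \<omega>)}"
  unfolding finite_ladder_event_def first_ladder_epoch by auto

text \<open>Off the ladder event the height is the walk at the fixed default index
  \<open>the_enat \<infinity>\<close>. This keeps it measurable, and the conditional law gives that
  event no mass.\<close>

lemma ladder_height_eq:
  "ladder_height S X \<omega> = (if ascends (increments S X \<omega>) then first_height (increments S X \<omega>)
    else psum (increments S X \<omega>) (the_enat \<infinity>))"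
  unfolding ladder_height_def first_ladder_epoch by (simp add: walk_eq_psum first_height_def)

context gg1_queue
begin

lemma rv_service [measurable]: "1 \<le> i \<Longrightarrow> random_variable borel (S i)"
  using indep unfolding indep_vars_def by (auto dest: bspec[of _ _ "Inl i"])

lemma rv_arrival [measurable]: "1 \<le> i \<Longrightarrow> random_variable borel (X i)"
  using indep unfolding indep_vars_def by (auto dest: bspec[of _ _ "Inr i"])

lemma rv_increment [measurable]: "random_variable borel (\<lambda>\<omega>. increments S X \<omega> j)"
  unfolding increments_def by measurable

lemma rv_increments [measurable]:
  "increments S X \<in> measurable M (\<Pi>\<^sub>M i\<in>UNIV. borel)"
  by (rule measurable_PiM_single') auto

definition step_law :: "real measure" where
  "step_law = distr M borel (\<lambda>\<omega>. increments S X \<omega> 0)"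

text \<open>By independence the law of a service time and an inter-arrival time together is the
  product of two marginals that do not depend on \<open>j\<close>.\<close>

lemma distr_increment: "distr M borel (\<lambda>\<omega>. increments S X \<omega> j) = step_law"
proof -
  have law: "distr M borel (\<lambda>\<omega>. increments S X \<omega> j) =
      distr (distr M borel (S 1) \<Otimes>\<^sub>M distr M borel (X 1)) borel (\<lambda>(s, x). s - x)" for j
  proof -
    let ?Y = "case_sum S X" and ?a = "Inl (Suc j)" and ?b = "Inr (Suc (Suc j))"
    have "indep_var borel ((\<lambda>f. f ?a) \<circ> (\<lambda>\<omega>. restrict (\<lambda>i. ?Y i \<omega>) {?a}))
        borel ((\<lambda>f. f ?b) \<circ> (\<lambda>\<omega>. restrict (\<lambda>i. ?Y i \<omega>) {?b}))"
      by (rule indep_var_compose[OF indep_var_restrict[OF indep]]) auto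
    then have "indep_var borel (S (Suc j)) borel (X (Suc (Suc j)))"
      by (simp add: comp_def)
    then have pair: "distr M borel (S (Suc j)) \<Otimes>\<^sub>M distr M borel (X (Suc (Suc j))) =
        distr M (borel \<Otimes>\<^sub>M borel) (\<lambda>\<omega>. (S (Suc j) \<omega>, X (Suc (Suc j)) \<omega>))"
      by (simp only: indep_var_distribution_eq)
    have "distr M borel (\<lambda>\<omega>. increments S X \<omega> j) =
        distr (distr M (borel \<Otimes>\<^sub>M borel) (\<lambda>\<omega>. (S (Suc j) \<omega>, X (Suc (Suc j)) \<omega>))) borel (\<lambda>(s, x). s - x)"
      by (subst distr_distr) (auto simp: comp_def increments_def)
    then show ?thesis
      by (simp only: pair[symmetric] ident_service[of "Suc j", simplified] ident_arrival[of "Suc (Suc j)", simplified] One_nat_def)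
  qed
  show ?thesis unfolding step_law_def law ..
qed

text \<open>Step \<open>j\<close> reads only the index block \<open>K j\<close>, and these blocks
  are disjoint.\<close>

lemma indep_increments: "indep_vars (\<lambda>_. borel) (\<lambda>j \<omega>. increments S X \<omega> j) UNIV"
proof -
  define K :: "nat \<Rightarrow> (nat + nat) set" where "K j = {Inl (Suc j), Inr (Suc (Suc j))}" for j
  have "indep_vars (\<lambda>j. \<Pi>\<^sub>M i\<in>K j. borel) (\<lambda>j \<omega>. restrict (\<lambda>i. case_sum S X i \<omega>) (K j)) UNIV"
    by (rule indep_vars_restrict[OF indep]) (auto simp: K_def disjoint_family_on_def)
  then have "indep_vars (\<lambda>_. borel) (\<lambda>j \<omega>. (\<lambda>f. f (Inl (Suc j)) - f (Inr (Suc (Suc j))))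
      (restrict (\<lambda>i. case_sum S X i \<omega>) (K j))) UNIV"
    by (rule indep_vars_compose2)
       (auto simp: K_def intro!: borel_measurable_diff measurable_component_singleton)
  then show ?thesis
    by (simp add: K_def increments_def)
qed

sublocale walk: iid_walk step_law
proof -
  interpret step: prob_space step_law
    unfolding step_law_def by (rule prob_space_distr) measurable
  show "iid_walk step_law"
    by unfold_locales (auto simp: step_law_def)
qed

text \<open>This is the bridge between the queue and the canonical space; every statement about
  paths is carried over along this image measure.\<close>

lemma distr_increments: "distr M (\<Pi>\<^sub>M i\<in>UNIV. borel) (increments S X) = (\<Pi>\<^sub>M i\<in>UNIV. step_law)"
proof -
  have "distr M (\<Pi>\<^sub>M i\<in>UNIV. borel) (\<lambda>\<omega>. \<lambda>i\<in>UNIV. increments S X \<omega> i) =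
      (\<Pi>\<^sub>M i\<in>UNIV. distr M borel (\<lambda>\<omega>. increments S X \<omega> i))"
    using indep_increments by (subst (asm) indep_vars_iff_distr_eq_PiM) auto
  then show ?thesis
    by (simp add: distr_increment restrict_UNIV)
qed

lemma nn_integral_increments:
  "f \<in> borel_measurable (\<Pi>\<^sub>M i\<in>UNIV. borel) \<Longrightarrow>
    (\<integral>\<^sup>+u. f u \<partial>walk.P) = (\<integral>\<^sup>+\<omega>. f (increments S X \<omega>) \<partial>M)"
  unfolding distr_increments[symmetric] by (rule nn_integral_distr) measurable

lemma integral_increments:
  fixes f :: "_ \<Rightarrow> real"
  shows "f \<in> borel_measurable (\<Pi>\<^sub>M i\<in>UNIV. borel) \<Longrightarrow>
    (\<integral>u. f u \<partial>walk.P) = (\<integral>\<omega>. f (increments S X \<omega>) \<partial>M)"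
  unfolding distr_increments[symmetric] by (rule integral_distr) measurable

lemma integrable_increments:
  fixes f :: "_ \<Rightarrow> real"
  shows "f \<in> borel_measurable (\<Pi>\<^sub>M i\<in>UNIV. borel) \<Longrightarrow>
    integrable walk.P f \<longleftrightarrow> integrable M (\<lambda>\<omega>. f (increments S X \<omega>))"
  unfolding distr_increments[symmetric] by (rule integrable_distr_eq) measurable

lemma AE_increments:
  "Measurable.pred (\<Pi>\<^sub>M i\<in>UNIV. borel) Q \<Longrightarrow>
    (AE u in walk.P. Q u) \<longleftrightarrow> (AE \<omega> in M. Q (increments S X \<omega>))"
  unfolding distr_increments[symmetric]
  by (subst AE_distr_iff) (auto simp: space_PiM pred_def)

lemma ladder_prob_eq: "ladder_prob M S X = walk.\<eta>"
proof -
  have "walk.\<eta> = measure M (increments S X -` {u. ascends u} \<inter> space M)"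
    unfolding distr_increments[symmetric]
    by (rule measure_distr) (simp_all add: walk.sets_Collect_P flip: walk.sets_P)
  also have "increments S X -` {u. ascends u} \<inter> space M = finite_ladder_event M S X"
    by (auto simp: finite_ladder_event_eq)
  finally show ?thesis by (simp add: ladder_prob_def)
qed

lemma finite_ladder_event_sets [measurable]: "finite_ladder_event M S X \<in> sets M"
  unfolding finite_ladder_event_eq by measurable

lemma rv_ladder_height [measurable]: "random_variable borel (ladder_height S X)"
proof -
  have "(\<lambda>\<omega>. if ascends (increments S X \<omega>) then first_height (increments S X \<omega>)
    else psum (increments S X \<omega>) (the_enat \<infinity>)) \<in> borel_measurable M"
    by measurable
  then show ?thesis by (simp add: ladder_height_eq[abs_def])
qed

lemma uniform_measure_ladder:
  assumes "0 < walk.\<eta>"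
  shows "uniform_measure M (finite_ladder_event M S X) =
    density M (\<lambda>\<omega>. ennreal (indicator {u. ascends u} (increments S X \<omega>) / walk.\<eta>))"
  unfolding uniform_measure_def
proof (rule density_cong)
  have "emeasure M (finite_ladder_event M S X) = ennreal walk.\<eta>"
    unfolding ladder_prob_eq[symmetric] ladder_prob_def by (rule emeasure_eq_measure)
  then show "AE \<omega> in M. indicator (finite_ladder_event M S X) \<omega> / emeasure M (finite_ladder_event M S X) =
      ennreal (indicator {u. ascends u} (increments S X \<omega>) / walk.\<eta>)"
    using assms divide_ennreal[of 1 "walk.\<eta>"]
    by (intro AE_I2) (auto simp: finite_ladder_event_eq indicator_def)
qed measurable

text \<open>Conditioning on the ladder event is a density \<open>indicator / \<eta>\<close>, so
  conditional moments are moments over the event divided by \<eta>.\<close>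

lemma
  assumes "0 < walk.\<eta>"
  shows integrable_ladder_height_law: "integrable (ladder_height_law M S X) (\<lambda>y. y ^ k) \<longleftrightarrow>
      integrable walk.P (\<lambda>u. indicator {u. ascends u} u * first_height u ^ k)"
    and ladder_moment_eq: "ladder_moment M S X k =
      (\<integral>u. indicator {u. ascends u} u * first_height u ^ k \<partial>walk.P) / walk.\<eta>"
proof -
  have eq: "(indicator {u. ascends u} (increments S X \<omega>) / walk.\<eta>) *\<^sub>R ladder_height S X \<omega> ^ k =
      (\<lambda>u. 1 / walk.\<eta> * (indicator {u. ascends u} u * first_height u ^ k)) (increments S X \<omega>)" for \<omega>
    by (simp add: ladder_height_eq indicator_def)
  have "integrable (ladder_height_law M S X) (\<lambda>y. y ^ k) \<longleftrightarrow>
      integrable (uniform_measure M (finite_ladder_event M S X)) (\<lambda>\<omega>. ladder_height S X \<omega> ^ k)"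
    unfolding ladder_height_law_def by (rule integrable_distr_eq) measurable
  also have "\<dots> \<longleftrightarrow> integrable M (\<lambda>\<omega>. (indicator {u. ascends u} (increments S X \<omega>) / walk.\<eta>) *\<^sub>R ladder_height S X \<omega> ^ k)"
    unfolding uniform_measure_ladder[OF assms] by (rule integrable_density) auto
  also have "\<dots> \<longleftrightarrow> integrable walk.P (\<lambda>u. 1 / walk.\<eta> * (indicator {u. ascends u} u * first_height u ^ k))"
    unfolding eq by (rule integrable_increments[symmetric]) measurable
  finally show "integrable (ladder_height_law M S X) (\<lambda>y. y ^ k) \<longleftrightarrow>
      integrable walk.P (\<lambda>u. indicator {u. ascends u} u * first_height u ^ k)"
    using assms by (simp only: integrable_mult_left_iff) simp
  have "ladder_moment M S X k = (\<integral>\<omega>. ladder_height S X \<omega> ^ k \<partial>uniform_measure M (finite_ladder_event M S X))"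
    unfolding ladder_moment_def ladder_height_law_def by (rule integral_distr) measurable
  also have "\<dots> =
      (\<integral>\<omega>. (indicator {u. ascends u} (increments S X \<omega>) / walk.\<eta>) *\<^sub>R ladder_height S X \<omega> ^ k \<partial>M)"
    unfolding uniform_measure_ladder[OF assms] by (rule integral_density) auto
  also have "\<dots> = (\<integral>u. 1 / walk.\<eta> * (indicator {u. ascends u} u * first_height u ^ k) \<partial>walk.P)"
    unfolding eq by (rule integral_increments[symmetric]) measurable
  finally show "ladder_moment M S X k =
      (\<integral>u. indicator {u. ascends u} u * first_height u ^ k \<partial>walk.P) / walk.\<eta>"
    by simp
qed

text \<open>Inter-arrival times are nonnegative, so the positive part of a step is at most the
  service time.\<close>

lemma third_moment_increment:
  assumes "integrable M (\<lambda>\<omega>. S 1 \<omega> ^ 3)"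
  shows "(\<integral>\<^sup>+u. ennreal (max 0 (u 0) ^ 3) \<partial>walk.P) < \<infinity>"
proof -
  have "(\<integral>\<^sup>+u. ennreal (max 0 (u 0) ^ 3) \<partial>walk.P) = (\<integral>\<^sup>+\<omega>. ennreal (max 0 (increments S X \<omega> 0) ^ 3) \<partial>M)"
    by (rule nn_integral_increments) measurable
  also have "\<dots> \<le> (\<integral>\<^sup>+\<omega>. ennreal (norm (S 1 \<omega> ^ 3)) \<partial>M)"
  proof (rule nn_integral_mono_AE)
    show "AE \<omega> in M. ennreal (max 0 (increments S X \<omega> 0) ^ 3) \<le> ennreal (norm (S 1 \<omega> ^ 3))"
      using nonneg_service[of 1, simplified] nonneg_arrival[of 2, simplified]
    proof eventually_elim
      case (elim \<omega>)
      then have "max 0 (increments S X \<omega> 0) ^ 3 \<le> S 1 \<omega> ^ 3"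
        by (intro power_mono) (auto simp: increments_def numeral_2_eq_2)
      with elim show ?case by (intro ennreal_leI) simp
    qed
  qed
  also have "\<dots> < \<infinity>"
    using assms by (simp add: integrable_iff_bounded)
  finally show ?thesis .
qed

lemma distr_scaled_waiting_time:
  "distr M borel (\<lambda>\<omega>. c * waiting_time S X \<omega>) = distr walk.P borel (\<lambda>u. c * walk_sup u)"
  unfolding distr_increments[symmetric]
  by (subst distr_distr) (auto simp: comp_def waiting_time_eq_walk_sup)

lemma exponential_approximation:
  assumes third: "integrable M (\<lambda>\<omega>. S 1 \<omega> ^ 3)"
    and \<eta>: "0 < ladder_prob M S X" "ladder_prob M S X < 1"
  shows "AE \<omega> in M. \<exists>i. \<forall>j. walk S X j \<omega> \<le> walk S X i \<omega>"
    and "integrable M (waiting_time S X)"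
    and "integrable (ladder_height_law M S X) (\<lambda>y. y\<^sup>2)"
    and "wasserstein_dist (distr M borel (scaled_waiting_time M S X)) (exp_law 1)
      \<le> ereal (ladder_moment M S X 2 / (ladder_moment M S X 1)\<^sup>2
          * ((1 - ladder_prob M S X) / ladder_prob M S X))"
proof -
  have w\<eta>: "0 < walk.\<eta>" "walk.\<eta> < 1" using \<eta> by (simp_all add: ladder_prob_eq)
  show "AE \<omega> in M. \<exists>i. \<forall>j. walk S X j \<omega> \<le> walk S X i \<omega>"
    using walk.AE_attains_max[OF w\<eta>(2)]
    by (subst (asm) AE_increments) (auto simp: attains_max_def walk_eq_psum)
  have sq: "integrable walk.P (\<lambda>u. indicator {u. ascends u} u * (first_height u)\<^sup>2)"
    by (rule walk.integrable_first_height_sq[OF w\<eta> third_moment_increment[OF third]])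
  then show "integrable (ladder_height_law M S X) (\<lambda>y. y\<^sup>2)"
    by (simp add: integrable_ladder_height_law[OF w\<eta>(1)])
  have fst: "integrable walk.P (\<lambda>u. indicator {u. ascends u} u * first_height u)"
    by (rule walk.integrable_first_height[OF sq])
  show "integrable M (waiting_time S X)"
    using walk.integrable_walk_sup[OF w\<eta>(2) fst]
    by (subst (asm) integrable_increments) (auto simp: waiting_time_eq_walk_sup[abs_def])
  define m where "m = (\<integral>u. indicator {u. ascends u} u * first_height u \<partial>walk.P)"
  define m2 where "m2 = (\<integral>u. indicator {u. ascends u} u * (first_height u)\<^sup>2 \<partial>walk.P)"
  have "0 < m" unfolding m_def by (rule walk.mean_first_height_pos[OF w\<eta>(1) fst])
  have m: "ladder_moment M S X 1 = m / walk.\<eta>" "ladder_moment M S X 2 = m2 / walk.\<eta>"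
    by (simp_all add: ladder_moment_eq[OF w\<eta>(1)] m_def m2_def)
  have scale: "(1 - walk.\<eta>) / (walk.\<eta> * ladder_moment M S X 1) = (1 - walk.\<eta>) / m"
    unfolding m using w\<eta> by simp
  \<comment> \<open>Both conditional moments carry a factor 1/\<eta>; in the ratio one \<eta>
    survives and supplies the denominator of (1 - \<eta>)/\<eta>.\<close>
  have bound: "((1 - walk.\<eta>) / m)\<^sup>2 * m2 / (1 - walk.\<eta>) =
      ladder_moment M S X 2 / (ladder_moment M S X 1)\<^sup>2 * ((1 - walk.\<eta>) / walk.\<eta>)"
    using w\<eta> \<open>0 < m\<close> unfolding m by (simp add: field_simps power2_eq_square)
  show "wasserstein_dist (distr M borel (scaled_waiting_time M S X)) (exp_law 1)
      \<le> ereal (ladder_moment M S X 2 / (ladder_moment M S X 1)\<^sup>2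
          * ((1 - ladder_prob M S X) / ladder_prob M S X))"
    unfolding scaled_waiting_time_def[abs_def] distr_scaled_waiting_time ladder_prob_eq scale bound[symmetric]
    using walk.wasserstein_walk_sup[OF w\<eta> sq] by (simp only: m_def m2_def)
qed

end

section \<open>The simple random walk\<close>

locale simple_walk = iid_walk +
  fixes p :: real
  assumes p: "0 < p" "p < 1 / 2"
    and AE_step: "AE u in P. u 0 = 1 \<or> u 0 = - 1"
    and prob_up: "measure P {u. u 0 = 1} = p"
begin

lemma AE_steps: "AE u in P. \<forall>n. u n = 1 \<or> u n = - 1"
proof -
  have "AE u in P. shift_seq n u 0 = 1 \<or> shift_seq n u 0 = - 1" for n
    using AE_step by (intro AE_shift) measurable
  then show ?thesis by (simp add: AE_all_countable shift_seq_def)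
qed

lemma prob_down: "measure P {u. u 0 = - 1} = 1 - p"
proof -
  have compl: "{u. u 0 \<noteq> 1} = space P - {u. u 0 = 1}" by auto
  have "measure P {u. u 0 = - 1} = measure P {u. u 0 \<noteq> 1}"
    by (intro measure_eq_AE, use AE_step in eventually_elim) auto
  also have "\<dots> = 1 - p"
    unfolding compl by (subst seq.P.prob_compl) (auto simp: prob_up)
  finally show ?thesis .
qed

lemma psum_in_Ints:
  assumes "\<And>n. u n = 1 \<or> u n = - 1"
  shows "psum u n \<in> \<int>"
proof (induction n)
  case (Suc n)
  then show ?case using assms[of n] by (auto simp: psum_Suc)
qed simp

lemma Ints_pos_ge_1: "(x :: real) \<in> \<int> \<Longrightarrow> 0 < x \<Longrightarrow> 1 \<le> x"
  by (auto elim!: Ints_cases)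

text \<open>An integer-valued walk enters the positive side from a height at most 0 by a step of
  size 1, so it cannot overshoot.\<close>

lemma first_height_simple:
  assumes u: "\<And>n. u n = 1 \<or> u n = - 1" and "ascends u"
  shows "first_height u = 1"
proof -
  obtain n where n: "hit u = Suc n"
    using psum_hit[OF assms(2)] by (cases "hit u") auto
  have "psum u n \<le> 0" using psum_before_hit[of n u] n by simp
  moreover have "1 \<le> psum u n + u n"
    using Ints_pos_ge_1[OF psum_in_Ints[of u "Suc n", OF u]] psum_hit[OF assms(2)] by (simp add: n psum_Suc)
  ultimately show ?thesis
    using u[of n] by (auto simp: first_height_def n psum_Suc)
qed

lemma AE_first_height: "AE u in P. ascends u \<longrightarrow> first_height u = 1"
  using AE_steps by eventually_elim (auto intro: first_height_simple)

text \<open>Without overshoot, climbing two levels means climbing one level twice, which the strong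
  Markov property turns into \<eta> squared.\<close>

lemma reach_2_iff:
  assumes u: "\<And>n. u n = 1 \<or> u n = - 1"
  shows "(\<exists>n. 2 \<le> psum u n) \<longleftrightarrow> ascends u \<and> ascends (shift_seq (hit u) u)"
proof (intro iffI conjI)
  assume "\<exists>n. 2 \<le> psum u n"
  then obtain n where n: "2 \<le> psum u n" ..
  then have "0 < psum u n" by linarith
  then show asc: "ascends u" by (auto simp: ascends_def)
  have "hit u \<le> n" unfolding hit_def by (rule Least_le) fact
  then have "psum u n = 1 + psum (shift_seq (hit u) u) (n - hit u)"
    using psum_add[of u "hit u" "n - hit u"] first_height_simple[OF u asc] by (simp add: first_height_def)
  with n show "ascends (shift_seq (hit u) u)"
    by (auto simp: ascends_def intro!: exI[of _ "n - hit u"])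
next
  assume asc: "ascends u \<and> ascends (shift_seq (hit u) u)"
  then obtain k where k: "0 < psum (shift_seq (hit u) u) k" by (auto simp: ascends_def)
  have "psum (shift_seq (hit u) u) k \<in> \<int>"
    using u by (intro psum_in_Ints) (simp add: shift_seq_def)
  from Ints_pos_ge_1[OF this k] have "2 \<le> psum u (hit u + k)"
    using first_height_simple[OF u] asc by (simp add: psum_add first_height_def)
  then show "\<exists>n. 2 \<le> psum u n" ..
qed

lemma prob_reach_2: "measure P {u. \<exists>n. 2 \<le> psum u n} = \<eta>\<^sup>2"
proof -
  have [measurable]: "Measurable.pred P (\<lambda>u. \<exists>n. 2 \<le> psum u n)" by measurable
  have "emeasure P {u. \<exists>n. 2 \<le> psum u n} = (\<integral>\<^sup>+u. indicator {u. \<exists>n. 2 \<le> psum u n} u \<partial>P)"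
    by (rule nn_integral_indicator[symmetric]) measurable
  also have "\<dots> = (\<integral>\<^sup>+u. indicator {u. ascends u} u * indicator {u. ascends u} (shift_seq (hit u) u) \<partial>P)"
    by (intro nn_integral_cong_AE, use AE_steps in eventually_elim) (simp add: reach_2_iff indicator_def)
  also have "\<dots> = (\<integral>\<^sup>+u. \<integral>\<^sup>+v. indicator {u. ascends u} u * indicator {u. ascends u} v \<partial>P \<partial>P)"
    using strong_markov[of "\<lambda>(_, v). indicator {u. ascends u} v"] by simp
  also have "\<dots> = ennreal \<eta> * ennreal \<eta>"
    by (simp add: nn_integral_cmult nn_integral_multc emeasure_ascends)
  also have "\<dots> = ennreal (\<eta>\<^sup>2)"
    by (simp add: power2_eq_square ennreal_mult)
  finally show ?thesis by (simp add: seq.P.emeasure_eq_measure)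
qed

lemma measure_split:
  assumes [measurable]: "Measurable.pred P A" "Measurable.pred P B"
    and "\<And>u v. A (comb_seq n u v) = A u"
  shows "measure P {u. A u \<and> B (shift_seq n u)} = measure P {u. A u} * measure P {u. B u}"
  using emeasure_split[OF assms]
  by (simp add: seq.P.emeasure_eq_measure flip: ennreal_mult)

text \<open>Condition on the first step: up, and the walk has ascended; down, and it still has to
  climb two levels.\<close>

lemma prob_ascends_quadratic: "\<eta> = p + (1 - p) * \<eta>\<^sup>2"
proof -
  let ?R = "\<lambda>u. \<exists>n. 2 \<le> psum u n"
  have [measurable]: "Measurable.pred P ?R" by measurable
  have "\<eta> = measure P ({u. u 0 = 1} \<union> {u. u 0 = - 1 \<and> ?R (shift_seq 1 u)})"
  proof (intro measure_eq_AE, use AE_steps in eventually_elim)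
    case (elim u)
    have "ascends u \<longleftrightarrow> u 0 = 1 \<or> u 0 = - 1 \<and> ?R (shift_seq 1 u)"
    proof (cases "u 0 = 1")
      case True
      then have "0 < psum u 1" by (simp add: psum_def)
      with True show ?thesis by (auto simp: ascends_def)
    next
      case False
      with elim have u0: "u 0 = - 1" by blast
      have Suc: "psum u (Suc n) = psum (shift_seq 1 u) n - 1" for n
        using psum_add[of u 1 n] u0 by (simp add: psum_def)
      have int: "psum (shift_seq 1 u) n - 1 \<in> \<int>" for n
        unfolding Suc[symmetric] by (rule psum_in_Ints) (use elim in blast)
      have "ascends u \<longleftrightarrow> (\<exists>n. 0 < psum u (Suc n))"
        unfolding ascends_def
      proof
        assume "\<exists>n. 0 < psum u n"
        then obtain n where "0 < psum u n" ..
        then show "\<exists>n. 0 < psum u (Suc n)" by (cases n) auto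
      qed blast
      also have "\<dots> \<longleftrightarrow> ?R (shift_seq 1 u)"
      proof -
        have "0 < psum u (Suc n) \<longleftrightarrow> 2 \<le> psum (shift_seq 1 u) n" for n
          using Ints_pos_ge_1[OF int[of n]] unfolding Suc by linarith
        then show ?thesis by simp
      qed
      finally show ?thesis using u0 by simp
    qed
    then show ?case by simp
  qed measurable
  also have "\<dots> = measure P {u. u 0 = 1} + measure P {u. u 0 = - 1 \<and> ?R (shift_seq 1 u)}"
    by (intro seq.P.finite_measure_Union) auto
  also have "measure P {u. u 0 = - 1 \<and> ?R (shift_seq 1 u)} = measure P {u. u 0 = - 1} * measure P {u. ?R u}"
    by (rule measure_split) (auto simp: comb_seq_def)
  finally show ?thesis unfolding prob_up prob_down prob_reach_2 .
qed

text \<open>This excludes the root \<open>1\<close> of the quadratic equation for \<open>\<eta>\<close>.\<close>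

lemma lundberg_bound:
  "measure P {u. \<exists>k\<le>n. m \<le> psum u k} \<le> ((1 - p) / p) powr (- m)"
proof (induction n arbitrary: m)
  have r: "1 < (1 - p) / p" using p by (simp add: field_simps)
  have trivial: "measure P {u. \<exists>k\<le>n. m \<le> psum u k} \<le> ((1 - p) / p) powr (- m)" if "m \<le> 0" for n m
    using ge_one_powr_ge_zero[of "(1 - p) / p" "- m"] r that
    by (intro order_trans[OF seq.P.prob_le_1]) auto
  {
    case 0
    show ?case
    proof (cases "m \<le> 0")
      case False
      then have "{u. \<exists>k\<le>0. m \<le> psum u k} = {}" by auto
      then show ?thesis by simp
    qed (rule trivial)
  next
    case (Suc n)
    show ?case
    proof (cases "m \<le> 0")
      case False
      let ?A = "\<lambda>m u. \<exists>k\<le>n. m \<le> psum u k"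
      have [measurable]: "Measurable.pred P (?A m)" for m by measurable
      have "measure P {u. \<exists>k\<le>Suc n. m \<le> psum u k} \<le>
          measure P ({u. u 0 = 1 \<and> ?A (m - 1) (shift_seq 1 u)} \<union> {u. u 0 = - 1 \<and> ?A (m + 1) (shift_seq 1 u)})"
      proof (rule seq.P.finite_measure_mono_AE)
        show "AE u in P. u \<in> {u. \<exists>k\<le>Suc n. m \<le> psum u k} \<longrightarrow>
            u \<in> {u. u 0 = 1 \<and> ?A (m - 1) (shift_seq 1 u)} \<union> {u. u 0 = - 1 \<and> ?A (m + 1) (shift_seq 1 u)}"
          using AE_step
        proof eventually_elim
          case (elim u)
          show ?case
          proof
            assume "u \<in> {u. \<exists>k\<le>Suc n. m \<le> psum u k}"
            then obtain k where k: "k \<le> Suc n" "m \<le> psum u k" by auto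
            with False obtain j where j: "k = Suc j" by (cases k) auto
            have "m - u 0 \<le> psum (shift_seq 1 u) j"
              using k j psum_add[of u 1 j] by (simp add: psum_def)
            with k j have "?A (m - u 0) (shift_seq 1 u)" by auto
            with elim show "u \<in> {u. u 0 = 1 \<and> ?A (m - 1) (shift_seq 1 u)} \<union> {u. u 0 = - 1 \<and> ?A (m + 1) (shift_seq 1 u)}"
              by auto
          qed
        qed
      qed measurable
      also have "\<dots> \<le> measure P {u. u 0 = 1 \<and> ?A (m - 1) (shift_seq 1 u)}
          + measure P {u. u 0 = - 1 \<and> ?A (m + 1) (shift_seq 1 u)}"
        by (intro measure_Un_le) measurable
      also have "measure P {u. u 0 = 1 \<and> ?A (m - 1) (shift_seq 1 u)} = p * measure P {u. ?A (m - 1) u}"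
        by (subst measure_split) (auto simp: comb_seq_def prob_up)
      also have "measure P {u. u 0 = - 1 \<and> ?A (m + 1) (shift_seq 1 u)} = (1 - p) * measure P {u. ?A (m + 1) u}"
        by (subst measure_split) (auto simp: comb_seq_def prob_down)
      also have "p * measure P {u. ?A (m - 1) u} + (1 - p) * measure P {u. ?A (m + 1) u} \<le>
          p * ((1 - p) / p) powr (- (m - 1)) + (1 - p) * ((1 - p) / p) powr (- (m + 1))"
        using p by (intro add_mono mult_left_mono Suc.IH) auto
      \<comment> \<open>With r = (1 - p)/p one has p r + (1 - p)/r = 1, so the bound is harmonic for
        the walk.\<close>
      also have "\<dots> = ((1 - p) / p) powr (- m)"
        using p r by (simp add: powr_diff powr_add powr_minus field_simps)
      finally show ?thesis .
    qed (rule trivial)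
  }
qed

lemma prob_ascends_less_1: "\<eta> < 1"
proof -
  let ?A = "\<lambda>n. {u. \<exists>k\<le>n. 1 \<le> psum u k}"
  have "(\<lambda>n. measure P (?A n)) \<longlonglongrightarrow> measure P (\<Union>n. ?A n)"
    by (intro seq.P.finite_Lim_measure_incseq) (auto simp: incseq_def intro: order_trans)
  then have "measure P (\<Union>n. ?A n) \<le> ((1 - p) / p) powr (- 1)"
    by (rule LIMSEQ_le_const2) (use lundberg_bound in blast)
  also have "\<dots> < 1" using p by (simp add: powr_minus field_simps)
  also have "measure P (\<Union>n. ?A n) = \<eta>"
  proof (intro measure_eq_AE, use AE_steps in eventually_elim)
    case (elim u)
    then have "1 \<le> psum u n" if "0 < psum u n" for n
      using that by (intro Ints_pos_ge_1 psum_in_Ints) auto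
    then show ?case by (auto simp: ascends_def intro: less_le_trans[OF zero_less_one])
  qed measurable
  finally show ?thesis .
qed

lemma prob_ascends: "\<eta> = p / (1 - p)"
proof -
  \<comment> \<open>The quadratic has the roots 1 and p/(1 - p); the right-hand side is written as a
    multiple of the equation so that it visibly vanishes.\<close>
  have "(1 - \<eta>) * ((1 - p) * \<eta> - p) = p + (1 - p) * \<eta>\<^sup>2 - \<eta> - 2 * (p + (1 - p) * \<eta>\<^sup>2 - \<eta>)"
    by (simp add: algebra_simps power2_eq_square)
  also have "\<dots> = 0" using prob_ascends_quadratic by simp
  finally have "(1 - p) * \<eta> = p" using prob_ascends_less_1 by simp
  with p show ?thesis by (simp add: field_simps)
qed

lemma moment_first_height: "(\<integral>u. indicator {u. ascends u} u * first_height u ^ k \<partial>P) = \<eta>"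
proof -
  have "(\<integral>u. indicator {u. ascends u} u * first_height u ^ k \<partial>P) = (\<integral>u. indicator {u. ascends u} u \<partial>P)"
    by (intro integral_cong_AE, measurable, use AE_first_height in eventually_elim) (auto simp: indicator_def)
  then show ?thesis by simp
qed

text \<open>For an exponential test function and unit ladder height the fixed point equation is
  linear in the Laplace transform: l = \<eta> exp(-a) l + (1 - \<eta>).\<close>

lemma laplace_walk_sup:
  assumes "0 < a"
  shows "(\<integral>u. exp (- (a * walk_sup u)) \<partial>P) * (1 - \<eta> * exp (- a)) = 1 - \<eta>"
proof -
  let ?f = "\<lambda>x::real. ennreal (exp (- (a * x)))"
  have nonneg: "AE u in P. 0 \<le> walk_sup u"
    using AE_attains_max[OF prob_ascends_less_1] by eventually_elim (rule walk_sup_nonneg)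
  have int: "integrable P (\<lambda>u. exp (- (a * walk_sup u)))"
  proof (rule seq.P.integrable_const_bound[of _ 1])
    show "AE u in P. norm (exp (- (a * walk_sup u))) \<le> 1"
      using nonneg by eventually_elim (use assms in simp)
  qed measurable
  define l where "l = (\<integral>u. exp (- (a * walk_sup u)) \<partial>P)"
  have "0 \<le> l" unfolding l_def by (intro Bochner_Integration.integral_nonneg) simp
  have l: "(\<integral>\<^sup>+u. ?f (walk_sup u) \<partial>P) = ennreal l"
    unfolding l_def by (intro nn_integral_eq_integral int) simp
  have "ennreal l = (\<integral>\<^sup>+u. \<integral>\<^sup>+v. ?f (if ascends u then first_height u + walk_sup v else 0) \<partial>P \<partial>P)"
    unfolding l[symmetric] by (intro nn_integral_walk_sup prob_ascends_less_1) measurable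
  also have "\<dots> = (\<integral>\<^sup>+u. indicator {u. ascends u} u * ennreal (exp (- a) * l) + indicator {u. \<not> ascends u} u \<partial>P)"
  proof (intro nn_integral_cong_AE, use AE_first_height in eventually_elim)
    case (elim u)
    show ?case
    proof (cases "ascends u")
      case True
      with elim have "(\<integral>\<^sup>+v. ?f (if ascends u then first_height u + walk_sup v else 0) \<partial>P) =
          (\<integral>\<^sup>+v. ennreal (exp (- a)) * ?f (walk_sup v) \<partial>P)"
        by (intro nn_integral_cong) (simp add: distrib_left mult_exp_exp flip: ennreal_mult)
      also have "\<dots> = ennreal (exp (- a) * l)"
        using \<open>0 \<le> l\<close> by (simp add: nn_integral_cmult l ennreal_mult)
      finally show ?thesis using True by simp
    qed (simp add: seq.P.emeasure_space_1[simplified])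
  qed
  also have "\<dots> = ennreal \<eta> * ennreal (exp (- a) * l) + ennreal (1 - \<eta>)"
    by (simp add: nn_integral_add nn_integral_multc emeasure_ascends emeasure_not_ascends)
  also have "\<dots> = ennreal (\<eta> * (exp (- a) * l) + (1 - \<eta>))"
    using \<open>0 \<le> l\<close> prob_ascends_less_1 by (simp add: ennreal_mult)
  finally have "l = \<eta> * (exp (- a) * l) + (1 - \<eta>)"
    using \<open>0 \<le> l\<close> prob_ascends_less_1 by (subst (asm) ennreal_inj) auto
  then show ?thesis by (simp add: l_def[symmetric] algebra_simps)
qed

end

section \<open>The rate\<close>

lemma exp_minus_lipschitz: "1-lipschitz_on {0..} (\<lambda>x::real. exp (- x))"
proof (rule lipschitz_onI)
  have *: "exp (- x) - exp (- y) \<le> y - x" if "0 \<le> x" "x \<le> y" for x y :: real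
  proof -
    have "exp (- x) - exp (- y) = exp (- x) * (1 - exp (- (y - x)))"
      by (simp add: right_diff_distrib mult_exp_exp)
    also have "\<dots> \<le> 1 * (y - x)"
    proof (rule mult_mono)
      show "1 - exp (- (y - x)) \<le> y - x"
        using exp_ge_add_one_self[of "- (y - x)"] by linarith
    qed (use that in auto)
    finally show ?thesis by simp
  qed
  fix x y :: real assume "x \<in> {0..}" "y \<in> {0..}"
  then show "dist (exp (- x)) (exp (- y)) \<le> 1 * dist x y"
    using *[of x y] *[of y x] by (cases "x \<le> y") (auto simp: dist_real_def)
qed simp

text \<open>The integrand exp(-2t) is half the density of the exponential law of rate 2.\<close>

lemma laplace_exp_law: "(LINT x:{0..}|exp_law 1. exp (- x)) = 1 / 2"
proof -
  interpret E: prob_space "density lborel (exponential_density 2)"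
    by (rule prob_space_exponential_density) simp
  have "(\<integral>\<^sup>+t. ennreal (exponential_density 2 t) \<partial>lborel) = 1"
    using E.emeasure_space_1 by (simp add: emeasure_density)
  then have "has_bochner_integral lborel (exponential_density 2) 1"
    by (intro has_bochner_integral_nn_integral) (auto simp: exponential_density_nonneg)
  then have "integral\<^sup>L lborel (exponential_density 2) = 1"
    by (rule has_bochner_integral_integral_eq)
  moreover have "exponential_density 2 = (\<lambda>t. 2 * (indicator {0..} t * (exp (- t) * exp (- t))))"
    by (auto simp: fun_eq_iff exponential_density_def indicator_def mult_exp_exp)
  ultimately have "2 * (\<integral>t. indicator {0..} t * (exp (- t) * exp (- t)) \<partial>lborel) = (1::real)"
    by simp
  then show ?thesis by (subst set_integral_exp_law) auto
qed

text \<open>The expansion of exp(-a), with \<eta> a = 1 - \<eta>, gives 1 - \<eta> exp(-a) \<le> (1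
  - \<eta>)(2 - a/3), so l is at least 1/(2 - a/3), about 1/2 + a/12. This is the origin of
  1/12.\<close>

lemma laplace_gap:
  fixes \<eta> a l :: real
  assumes \<eta>: "1 / 2 \<le> \<eta>" "\<eta> < 1" and a: "a = (1 - \<eta>) / \<eta>"
    and l: "l * (1 - \<eta> * exp (- a)) = 1 - \<eta>"
  shows "1 / 12 * (1 - \<eta>) \<le> l - 1 / 2"
proof -
  have a': "0 < a" "a \<le> 1" "\<eta> * a = 1 - \<eta>"
    using \<eta> by (auto simp: a field_simps)
  then have "1 - \<eta> \<le> a"
    using mult_right_mono[of \<eta> 1 a] \<eta> by simp
  obtain t where "exp (- a) = (\<Sum>m<4. (- a) ^ m / fact m) + exp t / fact 4 * (- a) ^ 4"
    using Maclaurin_exp_le[of "- a" 4] by auto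
  moreover have "0 \<le> exp t / fact 4 * (- a) ^ 4" by simp
  ultimately have "(\<Sum>m<4. (- a) ^ m / fact m) \<le> exp (- a)" by linarith
  then have "1 - a + a\<^sup>2 / 2 - a ^ 3 / 6 \<le> exp (- a)"
    by (simp add: eval_nat_numeral fact_numeral)
  \<comment> \<open>Here \<eta> \<ge> 1/2 enters through a \<le> 1: the cubic term costs at most
    \<open>a\<^sup>2 / 6\<close>, which leaves \<open>a\<^sup>2 / 3\<close> of
    \<open>a\<^sup>2 / 2\<close>.\<close>
  moreover have "a ^ 3 \<le> a\<^sup>2"
    using a' by (intro power_decreasing) auto
  ultimately have "1 - a + a\<^sup>2 / 3 \<le> exp (- a)" by linarith
  then have "\<eta> * (1 - a + a\<^sup>2 / 3) \<le> \<eta> * exp (- a)"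
    using \<eta> by (intro mult_left_mono) auto
  moreover have "\<eta> * (1 - a + a\<^sup>2 / 3) = \<eta> - \<eta> * a + (\<eta> * a) * a / 3"
    by (simp add: algebra_simps power2_eq_square)
  ultimately have upper: "1 - \<eta> * exp (- a) \<le> (1 - \<eta>) * (2 - a / 3)"
    unfolding a'(3) by (simp add: algebra_simps)
  have "\<eta> * exp (- a) < 1"
    using \<eta> a' mult_strict_mono[of \<eta> 1 "exp (- a)" 1] by simp
  then have "0 < l"
    using l \<eta> by (metis diff_gt_0_iff_gt zero_less_mult_pos2)
  have "1 - \<eta> \<le> l * ((1 - \<eta>) * (2 - a / 3))"
    using mult_left_mono[OF upper, of l] \<open>0 < l\<close> l by simp
  then have "(1 - \<eta>) * 1 \<le> (1 - \<eta>) * (l * (2 - a / 3))" by (simp add: algebra_simps)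
  then have "1 \<le> l * (2 - a / 3)" using \<eta> by simp
  moreover have "(1 / 2 + (1 - \<eta>) / 12) * (2 - a / 3) \<le> 1"
  proof -
    have "0 \<le> (1 - \<eta>) * a / 36" using \<eta> a' by simp
    with \<open>1 - \<eta> \<le> a\<close> have "1 - a / 6 + (1 - \<eta>) / 6 - (1 - \<eta>) * a / 36 \<le> 1" by argo
    also have "1 - a / 6 + (1 - \<eta>) / 6 - (1 - \<eta>) * a / 36 = (1 / 2 + (1 - \<eta>) / 12) * (2 - a / 3)"
      by (simp add: field_simps)
    finally show ?thesis .
  qed
  ultimately have "(1 / 2 + (1 - \<eta>) / 12) * (2 - a / 3) \<le> l * (2 - a / 3)" by linarith
  then have "1 / 2 + (1 - \<eta>) / 12 \<le> l"
    using a'(2) by (subst (asm) mult_le_cancel_right) auto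
  then show ?thesis by argo
qed

section \<open>A queue whose walk is a simple random walk\<close>

definition service_law :: "real \<Rightarrow> real measure" where
  "service_law p = distr (measure_pmf (bernoulli_pmf p)) borel (\<lambda>b. if b then 2 else 0)"

definition queue_law :: "real \<Rightarrow> nat + nat \<Rightarrow> real measure" where
  "queue_law p = case_sum (\<lambda>_. service_law p) (\<lambda>_. return borel 1)"

definition queue_space :: "real \<Rightarrow> (nat + nat \<Rightarrow> real) measure" where
  "queue_space p = PiM UNIV (queue_law p)"

definition service :: "nat \<Rightarrow> (nat + nat \<Rightarrow> real) \<Rightarrow> real" where
  "service i \<omega> = \<omega> (Inl i)"

definition arrival :: "nat \<Rightarrow> (nat + nat \<Rightarrow> real) \<Rightarrow> real" where
  "arrival i \<omega> = \<omega> (Inr i)"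

lemma prob_space_queue_law: "prob_space (queue_law p i)"
  unfolding queue_law_def service_law_def
  by (cases i) (auto intro!: prob_space_return measure_pmf.prob_space_distr)

lemma sets_queue_law [simp, measurable_cong]: "sets (queue_law p i) = sets borel"
  by (cases i) (simp_all add: queue_law_def service_law_def)

lemma sets_queue_space [measurable_cong]: "sets (queue_space p) = sets (PiM UNIV (\<lambda>_. borel))"
  unfolding queue_space_def by (intro sets_PiM_cong) auto

lemma distr_queue_coordinate: "distr (queue_space p) borel (\<lambda>\<omega>. \<omega> i) = queue_law p i"
proof -
  have "distr (queue_space p) borel (\<lambda>\<omega>. \<omega> i) = distr (queue_space p) (queue_law p i) (\<lambda>\<omega>. \<omega> i)"
    by (intro distr_cong) auto
  also have "\<dots> = queue_law p i"
    unfolding queue_space_def by (intro distr_PiM_component prob_space_queue_law) simp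
  finally show ?thesis .
qed

lemma AE_queue_coordinate:
  assumes [measurable]: "Measurable.pred borel Q" and "AE x in queue_law p i. Q x"
  shows "AE \<omega> in queue_space p. Q (\<omega> i)"
  using assms(2) unfolding distr_queue_coordinate[symmetric]
  by (subst (asm) AE_distr_iff) auto

lemma AE_service: "AE \<omega> in queue_space p. service i \<omega> = 0 \<or> service i \<omega> = 2"
proof -
  have "AE x in queue_law p (Inl i). x = 0 \<or> x = 2"
    unfolding queue_law_def service_law_def sum.case by (subst AE_distr_iff) auto
  then show ?thesis
    unfolding service_def by (rule AE_queue_coordinate[rotated]) measurable
qed

lemma AE_arrival: "AE \<omega> in queue_space p. arrival i \<omega> = 1"
proof -
  have "AE x in queue_law p (Inr i). x = 1"
    unfolding queue_law_def sum.case by (subst AE_return) auto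
  then show ?thesis
    unfolding arrival_def by (rule AE_queue_coordinate[rotated]) measurable
qed

text \<open>Indexing the product space by the disjoint sum makes
  \<open>case_sum service arrival\<close> the family of coordinates, which are independent under a
  product measure.\<close>

lemma gg1_queue_example: "gg1_queue (queue_space p) service arrival"
proof -
  interpret prob_space "queue_space p"
    unfolding queue_space_def by (intro prob_space_PiM prob_space_queue_law)
  have "indep_vars (\<lambda>_. borel) (\<lambda>i \<omega>. \<omega> i) UNIV"
  proof (subst indep_vars_iff_distr_eq_PiM)
    have "distr (queue_space p) (PiM UNIV (\<lambda>_. borel)) (\<lambda>\<omega>. \<omega>) = queue_space p"
      by (rule distr_id2) (rule sets_queue_space[symmetric])
    then show "distr (queue_space p) (PiM UNIV (\<lambda>_. borel)) (\<lambda>\<omega>. \<lambda>i\<in>UNIV. \<omega> i) =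
        PiM UNIV (\<lambda>i. distr (queue_space p) borel (\<lambda>\<omega>. \<omega> i))"
      by (simp add: restrict_UNIV distr_queue_coordinate) (simp add: queue_space_def)
  qed auto
  moreover have "case_sum service arrival = (\<lambda>i \<omega>. \<omega> i)"
    by (auto simp: fun_eq_iff service_def arrival_def split: sum.split)
  ultimately have "indep_vars (\<lambda>_. borel) (case_sum service arrival) UNIV"
    by simp
  then have indep: "indep_vars (\<lambda>_. borel) (case_sum service arrival) ({1..} <+> {1..})"
    by (rule indep_vars_subset) simp
  show ?thesis
  proof
    show "distr (queue_space p) borel (service i) = distr (queue_space p) borel (service 1)" for i
      unfolding service_def[abs_def] distr_queue_coordinate by (simp add: queue_law_def)
    show "distr (queue_space p) borel (arrival i) = distr (queue_space p) borel (arrival 1)" for i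
      unfolding arrival_def[abs_def] distr_queue_coordinate by (simp add: queue_law_def)
    show "AE \<omega> in queue_space p. 0 \<le> service i \<omega>" for i
      using AE_service[where p=p and i=i] by eventually_elim auto
    show "AE \<omega> in queue_space p. 0 \<le> arrival i \<omega>" for i
      using AE_arrival[where p=p and i=i] by eventually_elim auto
  qed (rule indep)
qed

lemma measure_service_2:
  assumes "0 < p" "p < 1"
  shows "measure (queue_space p) {\<omega> \<in> space (queue_space p). service i \<omega> = 2} = p"
proof -
  have "{\<omega> \<in> space (queue_space p). service i \<omega> = 2} = (\<lambda>\<omega>. \<omega> (Inl i)) -` {2} \<inter> space (queue_space p)"
    by (auto simp: service_def)
  then have "measure (queue_space p) {\<omega> \<in> space (queue_space p). service i \<omega> = 2} =
      measure (distr (queue_space p) borel (\<lambda>\<omega>. \<omega> (Inl i))) {2}"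
    by (subst measure_distr) auto
  also have "\<dots> = measure (measure_pmf (bernoulli_pmf p)) ((\<lambda>b. if b then 2 else 0) -` {2::real})"
    unfolding distr_queue_coordinate by (simp add: queue_law_def service_law_def measure_distr)
  also have "(\<lambda>b. if b then 2 else 0) -` {2::real} = {True}"
    by (auto split: if_splits)
  also have "measure (measure_pmf (bernoulli_pmf p)) {True} = p"
    using assms by (simp add: measure_pmf_single)
  finally show ?thesis .
qed

text \<open>Service times \<open>0\<close> or \<open>2\<close> against unit inter-arrival times make the walk a simple random walk,
  so \<open>Y\<^sub>1 = 1\<close> and \<open>W\<close> is geometric with ratio \<open>\<eta> = p / (1 - p)\<close>. The Lipschitz function
  \<open>exp (- x)\<close> already separates the rescaled geometric law from the exponential law to first order.\<close>

lemma rate_optimal: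
  fixes \<eta> :: real
  assumes \<eta>: "1 / 2 \<le> \<eta>" "\<eta> < 1"
  obtains M :: "(nat + nat \<Rightarrow> real) measure" and S X where
    "gg1_queue M S X" "integrable M (\<lambda>\<omega>. S 1 \<omega> ^ 3)" "ladder_prob M S X = \<eta>"
    "ladder_moment M S X 2 / (ladder_moment M S X 1)\<^sup>2 \<le> 1"
    "ereal (1 / 12 * (1 - \<eta>)) \<le> wasserstein_dist (distr M borel (scaled_waiting_time M S X)) (exp_law 1)"
proof -
  \<comment> \<open>This inverts \<eta> = p/(1 - p).\<close>
  define p where "p = \<eta> / (1 + \<eta>)"
  have p: "0 < p" "p < 1 / 2" "p / (1 - p) = \<eta>"
    using \<eta> by (auto simp: p_def field_simps)
  let ?M = "queue_space p"
  interpret gg1_queue ?M service arrival by (rule gg1_queue_example)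
  have incr: "AE \<omega> in ?M. increments service arrival \<omega> 0 = service 1 \<omega> - 1"
    using AE_arrival[where p=p and i=2] by eventually_elim (simp add: increments_def numeral_2_eq_2)
  interpret sw: simple_walk step_law p
  proof
    show "AE u in walk.P. u 0 = 1 \<or> u 0 = - 1"
    proof (subst AE_increments[of "\<lambda>u. u 0 = 1 \<or> u 0 = - 1"])
      show "AE \<omega> in ?M. increments service arrival \<omega> 0 = 1 \<or> increments service arrival \<omega> 0 = - 1"
        using incr AE_service[where p=p and i=1] by eventually_elim auto
    qed (rule measurable_compose[of "\<lambda>u. u 0" _ borel "\<lambda>x. x = 1 \<or> x = - 1"]; measurable)
    have "measure walk.P {u. u 0 = 1} = measure ?M (increments service arrival -` {u. u 0 = 1} \<inter> space ?M)"
      unfolding distr_increments[symmetric]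
      by (rule measure_distr) (simp_all add: walk.sets_Collect_P flip: walk.sets_P)
    also have "\<dots> = measure ?M {\<omega> \<in> space ?M. service 1 \<omega> = 2}"
      by (intro measure_eq_AE, use incr in eventually_elim) auto
    also have "\<dots> = p" using p by (intro measure_service_2) auto
    finally show "measure walk.P {u. u 0 = 1} = p" .
  qed (use p in auto)
  have prob: "ladder_prob ?M service arrival = \<eta>"
    unfolding ladder_prob_eq sw.prob_ascends p(3) ..
  have w\<eta>: "walk.\<eta> = \<eta>" using prob by (simp add: ladder_prob_eq)
  have moment: "ladder_moment ?M service arrival k = 1" for k
    using \<eta> by (subst ladder_moment_eq) (auto simp: sw.moment_first_height w\<eta>)
  define a where "a = (1 - \<eta>) / \<eta>"
  have "0 < a" using \<eta> by (simp add: a_def)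
  have int: "integrable ?M (\<lambda>\<omega>. service 1 \<omega> ^ 3)"
    by (rule integrable_const_bound[of _ 8], use AE_service[where p=p and i=1] in eventually_elim) auto
  define l where "l = (\<integral>u. exp (- (a * walk_sup u)) \<partial>walk.P)"
  have l: "l * (1 - \<eta> * exp (- a)) = 1 - \<eta>"
    using sw.laplace_walk_sup[OF \<open>0 < a\<close>] by (simp only: w\<eta> l_def)
  have "(LINT x:{0..}|distr walk.P borel (\<lambda>u. a * walk_sup u). exp (- x)) =
      (\<integral>u. indicator {0..} (a * walk_sup u) *\<^sub>R exp (- (a * walk_sup u)) \<partial>walk.P)"
    unfolding set_lebesgue_integral_def by (intro integral_distr) measurable
  also have "\<dots> = l"
    unfolding l_def
  proof (intro integral_cong_AE)
    show "AE u in walk.P. indicator {0..} (a * walk_sup u) *\<^sub>R exp (- (a * walk_sup u)) = exp (- (a * walk_sup u))"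
      using walk.AE_attains_max[OF sw.prob_ascends_less_1]
      by eventually_elim (use \<open>0 < a\<close> in \<open>auto dest: walk_sup_nonneg\<close>)
  qed measurable
  finally have lap: "(LINT x:{0..}|distr walk.P borel (\<lambda>u. a * walk_sup u). exp (- x)) = l" .
  have "ereal (1 / 12 * (1 - \<eta>)) \<le> ereal \<bar>l - 1 / 2\<bar>"
    unfolding ereal_less_eq(3) using laplace_gap[OF \<eta> a_def l] abs_ge_self by (rule order_trans)
  also have "\<dots> \<le> wasserstein_dist (distr walk.P borel (\<lambda>u. a * walk_sup u)) (exp_law 1)"
    unfolding wasserstein_dist_def lap[symmetric] laplace_exp_law[symmetric]
    by (rule SUP_upper2[of "\<lambda>x. exp (- x)"]) (simp_all add: exp_minus_lipschitz)
  also have "distr walk.P borel (\<lambda>u. a * walk_sup u) = distr ?M borel (scaled_waiting_time ?M service arrival)"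
    unfolding scaled_waiting_time_def[abs_def] distr_scaled_waiting_time
    by (simp add: moment prob a_def)
  finally show thesis
    by (intro that[OF gg1_queue_axioms int prob]) (simp_all add: moment)
qed

theorem theorem1p2:
  shows
  "(\<forall>(M :: 'a measure) S X.
      gg1_queue M S X \<and> integrable M (\<lambda>\<omega>. S 1 \<omega> ^ 3) \<and>
      0 < ladder_prob M S X \<and> ladder_prob M S X < 1 \<longrightarrow>
        (AE \<omega> in M. \<exists>i. \<forall>j. walk S X j \<omega> \<le> walk S X i \<omega>) \<and>
        integrable M (waiting_time S X) \<and>
        integrable (ladder_height_law M S X) (\<lambda>y. y\<^sup>2) \<and>
        wasserstein_dist (distr M borel (scaled_waiting_time M S X)) (exp_law 1)
          \<le> ereal (ladder_moment M S X 2 / (ladder_moment M S X 1)\<^sup>2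
                   * ((1 - ladder_prob M S X) / ladder_prob M S X)))
   \<and>
   (\<exists>c>0. \<exists>K. \<forall>\<^sub>F \<eta> in at_left 1.
      \<exists>(M :: (nat + nat \<Rightarrow> real) measure) S X.
        gg1_queue M S X \<and> integrable M (\<lambda>\<omega>. S 1 \<omega> ^ 3) \<and>
        ladder_prob M S X = \<eta> \<and>
        ladder_moment M S X 2 / (ladder_moment M S X 1)\<^sup>2 \<le> K \<and>
        ereal (c * (1 - \<eta>))
          \<le> wasserstein_dist (distr M borel (scaled_waiting_time M S X)) (exp_law 1))"
proof (intro conjI allI impI)
  fix M :: "'a measure" and S X
  assume *: "gg1_queue M S X \<and> integrable M (\<lambda>\<omega>. S 1 \<omega> ^ 3) \<and>
      0 < ladder_prob M S X \<and> ladder_prob M S X < 1"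
  then interpret gg1_queue M S X by simp
  from * have "integrable M (\<lambda>\<omega>. S 1 \<omega> ^ 3)" "0 < ladder_prob M S X" "ladder_prob M S X < 1"
    by blast+
  note approximation = exponential_approximation[OF this]
  show "AE \<omega> in M. \<exists>i. \<forall>j. walk S X j \<omega> \<le> walk S X i \<omega>"
    by (rule approximation)
  show "integrable M (waiting_time S X)"
    by (rule approximation)
  show "integrable (ladder_height_law M S X) (\<lambda>y. y\<^sup>2)"
    by (rule approximation)
  show "wasserstein_dist (distr M borel (scaled_waiting_time M S X)) (exp_law 1)
      \<le> ereal (ladder_moment M S X 2 / (ladder_moment M S X 1)\<^sup>2
               * ((1 - ladder_prob M S X) / ladder_prob M S X))"
    by (rule approximation)
next
  have near_1: "eventually (\<lambda>\<eta>. \<eta> \<in> {1 / 2<..<1}) (at_left (1::real))"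
    by (rule eventually_at_left_real) simp
  show "\<exists>c>0. \<exists>K. \<forall>\<^sub>F \<eta> in at_left 1.
      \<exists>(M :: (nat + nat \<Rightarrow> real) measure) S X.
        gg1_queue M S X \<and> integrable M (\<lambda>\<omega>. S 1 \<omega> ^ 3) \<and>
        ladder_prob M S X = \<eta> \<and>
        ladder_moment M S X 2 / (ladder_moment M S X 1)\<^sup>2 \<le> K \<and>
        ereal (c * (1 - \<eta>))
          \<le> wasserstein_dist (distr M borel (scaled_waiting_time M S X)) (exp_law 1)"
  \<comment> \<open>The constant 1/12 is that of the Laplace transform gap; \<open>K = 1\<close>
    because the ladder height of the example is constantly 1.\<close>
  proof (rule exI[of _ "1 / 12"], intro conjI exI[of _ 1], goal_cases)
    case 2
    from near_1 show ?case
    proof eventually_elim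
      case (elim \<eta>)
      then have "1 / 2 \<le> \<eta>" "\<eta> < 1" by auto
      then show ?case by (rule rate_optimal) blast
    qed
  qed simp
qed

end
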